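(* Let $V=\{v_1,\dots,v_N\}$ be a collection of vectors spanning an $n$-dimensional complex vector space $E$. The algebra $\mathcal C_V$ is naturally isomorphic to the quotient $\mathrm{Sym}(E^* )/\mathcal I_V$, where $\mathcal I_V$ is the ideal generated by the powers $(\lambda_H)^{d(H)+1}$ of $V$-essential vectors for all $V$-essential hyperplanes $H$ in $E$. The isomorphism is induced by the embedding $p^*:E^*\to F^*$.
   Context: $V$ is a collection (family) of vectors indexed by $\{1,\dots,N\}$. Let $F=\mathbb C^N$ with distinguished basis $\phi^1,\dots,\phi^N$, let $p:F\to E$ be the linear map with $p(\phi^i)=v_i$, and $p^*:E^*\to F^*$ the dual (injective) map, with image $P=\mathrm{Im}(p^* )$. Let $\phi_1,\dots,\phi_N$ be the dual basis of $F^*$ and $\Phi_N=\mathrm{Sym}(F^* )/\langle\phi_i^2,\ i=1,\dots,N\rangle$. Then $\mathcal C_V$ is the (unital) subalgebra of $\Phi_N$ generated by the elements of $P$, i.e. the image of the map $\mathrm{Sym}(E^* )\to\Phi_N$ induced by $p^*$. A (linear) hyperplane $H\subset E$ is $V$-essential if the elements $\{v_i,\ i=1,\dots,N\mid v_i\in H\}$ span $H$. For such $H$, $I_H=\{i\in\{1,\dots,N\}\mid v_i\notin H\}$ and $d(H)=d_V(H)=|I_H|$. A $V$-essential vector $\lambda_H\in E^*$ is a nonzero linear functional with $H=\{x\in E\mid\lambda_H(x)=0\}$, for $H$ a $V$-essential hyperplane; it is defined up to a nonzero factor. *)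

theory Defs
  imports
    Complex_Main
    "HOL-Library.Poly_Mapping"
    "HOL-Library.Function_Algebras"
    "HOL-Algebra.QuotRing"
    "HOL-Algebra.Generated_Rings"
    "HOL-Algebra.Algebraic_Closure_Type"
begin

section \<open>Dual spaces\<close>

text \<open>
  A complex vector space is carried by a subset \<open>W\<close> of an abelian group with a scalar
  multiplication \<open>s\<close>. A functional on \<open>W\<close> is extended by zero outside \<open>W\<close>, so that it has exactly
  one representative and the vector space operations on functionals are the pointwise ones.
\<close>

definition dual_space :: "(complex \<Rightarrow> 'w::ab_group_add \<Rightarrow> 'w) \<Rightarrow> 'w set \<Rightarrow> ('w \<Rightarrow> complex) set" where
  "dual_space s W = {f.
      (\<forall>x\<in>W. \<forall>y\<in>W. f (x + y) = f x + f y) \<and>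
      (\<forall>c. \<forall>x\<in>W. f (s c x) = c * f x) \<and>
      (\<forall>x. x \<notin> W \<longrightarrow> f x = 0)}"

definition fun_scale :: "complex \<Rightarrow> ('w \<Rightarrow> complex) \<Rightarrow> ('w \<Rightarrow> complex)" where
  "fun_scale c f = (\<lambda>x. c * f x)"

section \<open>Symmetric algebras\<close>

text \<open>
  \<open>Sym(W)\<close> is the free commutative complex algebra on the underlying set of \<open>W\<close>, i.e. the polynomial
  ring with one variable for each element of \<open>W\<close>, modulo the ideal expressing that the
  inclusion of the variables is linear.
\<close>

type_synonym 'w cpoly = "('w \<Rightarrow>\<^sub>0 nat) \<Rightarrow>\<^sub>0 complex"

definition cpoly_var :: "'w \<Rightarrow> 'w cpoly" where
  "cpoly_var w = Poly_Mapping.single (Poly_Mapping.single w 1) 1"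

definition cpoly_const :: "complex \<Rightarrow> 'w cpoly" where
  "cpoly_const c = Poly_Mapping.single 0 c"

definition cpoly_ring :: "'w set \<Rightarrow> 'w cpoly ring" where
  "cpoly_ring W = ring_of_type_algebra
     \<lparr>carrier := {q. \<forall>m\<in>Poly_Mapping.keys q. Poly_Mapping.keys m \<subseteq> W}\<rparr>"

definition sym_relations ::
    "(complex \<Rightarrow> 'w::ab_group_add \<Rightarrow> 'w) \<Rightarrow> 'w set \<Rightarrow> 'w cpoly set" where
  "sym_relations s W =
     {cpoly_var (a + b) - (cpoly_var a + cpoly_var b) | a b. a \<in> W \<and> b \<in> W} \<union>
     {cpoly_var (s c a) - cpoly_const c * cpoly_var a | c a. a \<in> W}"

definition sym_ideal ::
    "(complex \<Rightarrow> 'w::ab_group_add \<Rightarrow> 'w) \<Rightarrow> 'w set \<Rightarrow> 'w cpoly set" where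
  "sym_ideal s W = Idl\<^bsub>cpoly_ring W\<^esub> (sym_relations s W)"

definition Sym ::
    "(complex \<Rightarrow> 'w::ab_group_add \<Rightarrow> 'w) \<Rightarrow> 'w set \<Rightarrow> 'w cpoly set ring" where
  "Sym s W = cpoly_ring W Quot sym_ideal s W"

text \<open>The canonical map from \<open>W\<close> to \<open>Sym(W)\<close>, and the structure map of \<open>Sym(W)\<close> as a complex algebra.\<close>

definition sym_incl ::
    "(complex \<Rightarrow> 'w::ab_group_add \<Rightarrow> 'w) \<Rightarrow> 'w set \<Rightarrow> 'w \<Rightarrow> 'w cpoly set" where
  "sym_incl s W w = sym_ideal s W +>\<^bsub>cpoly_ring W\<^esub> cpoly_var w"

definition sym_const ::
    "(complex \<Rightarrow> 'w::ab_group_add \<Rightarrow> 'w) \<Rightarrow> 'w set \<Rightarrow> complex \<Rightarrow> 'w cpoly set" where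
  "sym_const s W c = sym_ideal s W +>\<^bsub>cpoly_ring W\<^esub> cpoly_const c"

section \<open>The algebra \<open>\<Phi>\<^sub>N\<close>\<close>

definition coord_space :: "nat \<Rightarrow> (nat \<Rightarrow> complex) set" where
  "coord_space N = {x. \<forall>i. i \<notin> {1..N} \<longrightarrow> x i = 0}"

abbreviation F_dual :: "nat \<Rightarrow> ((nat \<Rightarrow> complex) \<Rightarrow> complex) set" where
  "F_dual N \<equiv> dual_space fun_scale (coord_space N)"

abbreviation Sym_F_dual :: "nat \<Rightarrow> ((nat \<Rightarrow> complex) \<Rightarrow> complex) cpoly set ring" where
  "Sym_F_dual N \<equiv> Sym fun_scale (F_dual N)"

definition coord_functional :: "nat \<Rightarrow> nat \<Rightarrow> (nat \<Rightarrow> complex) \<Rightarrow> complex" where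
  "coord_functional N i x = (if x \<in> coord_space N then x i else 0)"

definition squares_ideal :: "nat \<Rightarrow> ((nat \<Rightarrow> complex) \<Rightarrow> complex) cpoly set set" where
  "squares_ideal N = Idl\<^bsub>Sym_F_dual N\<^esub>
     {sym_incl fun_scale (F_dual N) (coord_functional N i) [^]\<^bsub>Sym_F_dual N\<^esub> (2::nat) | i. i \<in> {1..N}}"

definition Phi :: "nat \<Rightarrow> ((nat \<Rightarrow> complex) \<Rightarrow> complex) cpoly set set ring" where
  "Phi N = Sym_F_dual N Quot squares_ideal N"

definition phi_incl ::
    "nat \<Rightarrow> ((nat \<Rightarrow> complex) \<Rightarrow> complex) \<Rightarrow> ((nat \<Rightarrow> complex) \<Rightarrow> complex) cpoly set set" where
  "phi_incl N f = squares_ideal N +>\<^bsub>Sym_F_dual N\<^esub> sym_incl fun_scale (F_dual N) f"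

definition phi_const :: "nat \<Rightarrow> complex \<Rightarrow> ((nat \<Rightarrow> complex) \<Rightarrow> complex) cpoly set set" where
  "phi_const N c = squares_ideal N +>\<^bsub>Sym_F_dual N\<^esub> sym_const fun_scale (F_dual N) c"

section \<open>The algebra \<open>\<C>\<^sub>V\<close>\<close>

text \<open>
  The ambient space \<open>E\<close> is the whole type \<open>'e\<close> with scalar multiplication \<open>s\<close>, and the collection
  \<open>V\<close> is given by the values of \<open>v\<close> on the index set \<open>{1..N}\<close>.
\<close>

abbreviation E_dual :: "(complex \<Rightarrow> 'e::ab_group_add \<Rightarrow> 'e) \<Rightarrow> ('e \<Rightarrow> complex) set" where
  "E_dual s \<equiv> dual_space s UNIV"

abbreviation Sym_E_dual ::
    "(complex \<Rightarrow> 'e::ab_group_add \<Rightarrow> 'e) \<Rightarrow> ('e \<Rightarrow> complex) cpoly set ring" where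
  "Sym_E_dual s \<equiv> Sym fun_scale (E_dual s)"

definition p_map ::
    "(complex \<Rightarrow> 'e::ab_group_add \<Rightarrow> 'e) \<Rightarrow> nat \<Rightarrow> (nat \<Rightarrow> 'e) \<Rightarrow> (nat \<Rightarrow> complex) \<Rightarrow> 'e" where
  "p_map s N v x = (\<Sum>i\<in>{1..N}. s (x i) (v i))"

definition p_dual ::
    "(complex \<Rightarrow> 'e::ab_group_add \<Rightarrow> 'e) \<Rightarrow> nat \<Rightarrow> (nat \<Rightarrow> 'e)
      \<Rightarrow> ('e \<Rightarrow> complex) \<Rightarrow> (nat \<Rightarrow> complex) \<Rightarrow> complex" where
  "p_dual s N v l x = (if x \<in> coord_space N then l (p_map s N v x) else 0)"

definition C_alg ::
    "(complex \<Rightarrow> 'e::ab_group_add \<Rightarrow> 'e) \<Rightarrow> nat \<Rightarrow> (nat \<Rightarrow> 'e)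
      \<Rightarrow> ((nat \<Rightarrow> complex) \<Rightarrow> complex) cpoly set set ring" where
  "C_alg s N v = (Phi N)
     \<lparr>carrier := generate_ring (Phi N) (range (phi_const N) \<union> phi_incl N ` (p_dual s N v ` E_dual s))\<rparr>"

section \<open>Essential hyperplanes and the ideal \<open>\<I>\<^sub>V\<close>\<close>

definition linear_hyperplane :: "(complex \<Rightarrow> 'e::ab_group_add \<Rightarrow> 'e) \<Rightarrow> 'e set \<Rightarrow> bool" where
  "linear_hyperplane s H \<longleftrightarrow>
     module.subspace s H \<and> vector_space.dim s H + 1 = vector_space.dim s (UNIV :: 'e set)"

definition essential_hyperplane ::
    "(complex \<Rightarrow> 'e::ab_group_add \<Rightarrow> 'e) \<Rightarrow> nat \<Rightarrow> (nat \<Rightarrow> 'e) \<Rightarrow> 'e set \<Rightarrow> bool" where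
  "essential_hyperplane s N v H \<longleftrightarrow>
     linear_hyperplane s H \<and> module.span s {v i | i. i \<in> {1..N} \<and> v i \<in> H} = H"

definition hyperplane_degree :: "nat \<Rightarrow> (nat \<Rightarrow> 'e) \<Rightarrow> 'e set \<Rightarrow> nat" where
  "hyperplane_degree N v H = card {i\<in>{1..N}. v i \<notin> H}"

definition essential_vector ::
    "(complex \<Rightarrow> 'e::ab_group_add \<Rightarrow> 'e) \<Rightarrow> nat \<Rightarrow> (nat \<Rightarrow> 'e) \<Rightarrow> 'e set \<Rightarrow> ('e \<Rightarrow> complex) \<Rightarrow> bool" where
  "essential_vector s N v H l \<longleftrightarrow>
     essential_hyperplane s N v H \<and> l \<in> E_dual s \<and> l \<noteq> 0 \<and> H = {x. l x = 0}"

text \<open>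
  The functional \<open>\<lambda>\<^sub>H\<close> is only determined up to a nonzero factor; all choices are taken as generators,
  which does not change the ideal.
\<close>

definition I_ideal ::
    "(complex \<Rightarrow> 'e::ab_group_add \<Rightarrow> 'e) \<Rightarrow> nat \<Rightarrow> (nat \<Rightarrow> 'e) \<Rightarrow> ('e \<Rightarrow> complex) cpoly set set" where
  "I_ideal s N v = Idl\<^bsub>Sym_E_dual s\<^esub>
     {sym_incl fun_scale (E_dual s) l [^]\<^bsub>Sym_E_dual s\<^esub> (hyperplane_degree N v H + 1) | H l.
        essential_vector s N v H l}"

section \<open>The structures above are well formed\<close>

lemma cpoly_carrier:
  "q \<in> carrier (cpoly_ring W) \<longleftrightarrow> (\<forall>m\<in>Poly_Mapping.keys q. Poly_Mapping.keys m \<subseteq> W)"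
  by (simp add: cpoly_ring_def)

lemma cpoly_ops:
  "p \<otimes>\<^bsub>cpoly_ring W\<^esub> q = p * q" "p \<oplus>\<^bsub>cpoly_ring W\<^esub> q = p + q"
  "\<one>\<^bsub>cpoly_ring W\<^esub> = 1" "\<zero>\<^bsub>cpoly_ring W\<^esub> = 0"
  by (simp_all add: cpoly_ring_def ring_of_type_algebra_def)

lemma cpoly_var_in: "w \<in> W \<Longrightarrow> cpoly_var w \<in> carrier (cpoly_ring W)"
  by (simp add: cpoly_carrier cpoly_var_def)

lemma cpoly_const_in: "cpoly_const c \<in> carrier (cpoly_ring W)"
  by (simp add: cpoly_carrier cpoly_const_def)

lemma cpoly_uminus_in: "q \<in> carrier (cpoly_ring W) \<Longrightarrow> - q \<in> carrier (cpoly_ring W)"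
  by (simp add: cpoly_carrier in_keys_iff)

lemma cpoly_add_in:
  assumes "p \<in> carrier (cpoly_ring W)" "q \<in> carrier (cpoly_ring W)"
  shows "p + q \<in> carrier (cpoly_ring W)"
  using assms Poly_Mapping.keys_add[of p q] unfolding cpoly_carrier by blast

lemma cpoly_diff_in:
  assumes "p \<in> carrier (cpoly_ring W)" "q \<in> carrier (cpoly_ring W)"
  shows "p - q \<in> carrier (cpoly_ring W)"
  using cpoly_add_in[OF assms(1) cpoly_uminus_in[OF assms(2)]] by (simp only: add_uminus_conv_diff)

lemma cpoly_mult_in:
  assumes "p \<in> carrier (cpoly_ring W)" "q \<in> carrier (cpoly_ring W)"
  shows "p * q \<in> carrier (cpoly_ring W)"
  unfolding cpoly_carrier
proof
  fix m assume "m \<in> Poly_Mapping.keys (p * q)"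
  then obtain x y where m: "m = x + y" and "x \<in> Poly_Mapping.keys p" "y \<in> Poly_Mapping.keys q"
    using keys_mult[of p q] by blast
  then have "Poly_Mapping.keys x \<subseteq> W" "Poly_Mapping.keys y \<subseteq> W"
    using assms unfolding cpoly_carrier by blast+
  then show "Poly_Mapping.keys m \<subseteq> W"
    using Poly_Mapping.keys_add[of x y] unfolding m by blast
qed

lemma cring_cpoly: "cring (cpoly_ring W)"
proof (rule cringI)
  show "abelian_group (cpoly_ring W)"
  proof (rule abelian_groupI)
    fix x assume x: "x \<in> carrier (cpoly_ring W)"
    show "\<exists>y\<in>carrier (cpoly_ring W). y \<oplus>\<^bsub>cpoly_ring W\<^esub> x = \<zero>\<^bsub>cpoly_ring W\<^esub>"
      by (rule bexI[OF _ cpoly_uminus_in[OF x]]) (simp add: cpoly_ops)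
  qed (simp_all add: cpoly_ops cpoly_add_in add.assoc add.commute, simp add: cpoly_carrier)
  show "comm_monoid (cpoly_ring W)"
    by (rule comm_monoidI)
       (simp_all add: cpoly_ops cpoly_mult_in mult.assoc mult.commute, simp add: cpoly_carrier)
qed (simp add: cpoly_ops distrib_right)

lemma sym_relations_in:
  assumes "\<And>a b. a \<in> W \<Longrightarrow> b \<in> W \<Longrightarrow> a + b \<in> W" and "\<And>c a. a \<in> W \<Longrightarrow> s c a \<in> W"
  shows "sym_relations s W \<subseteq> carrier (cpoly_ring W)"
  unfolding sym_relations_def
  by (auto intro!: cpoly_diff_in cpoly_add_in cpoly_mult_in cpoly_var_in cpoly_const_in assms)

lemma dual_space_add: "f \<in> dual_space s W \<Longrightarrow> g \<in> dual_space s W \<Longrightarrow> f + g \<in> dual_space s W"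
  by (auto simp: dual_space_def algebra_simps)

lemma dual_space_scale: "f \<in> dual_space s W \<Longrightarrow> fun_scale c f \<in> dual_space s W"
  by (auto simp: dual_space_def fun_scale_def algebra_simps)

lemma ideal_sym_dual: "ideal (sym_ideal fun_scale (dual_space s W)) (cpoly_ring (dual_space s W))"
  unfolding sym_ideal_def
  by (intro ring.genideal_ideal cring.axioms(1) cring_cpoly sym_relations_in
        dual_space_add dual_space_scale)

lemma cring_Sym_dual: "cring (Sym fun_scale (dual_space s W))"
  unfolding Sym_def by (intro ideal.quotient_is_cring ideal_sym_dual cring_cpoly)

lemma sym_incl_in:
  "f \<in> dual_space s W \<Longrightarrow> sym_incl fun_scale (dual_space s W) f \<in> carrier (Sym fun_scale (dual_space s W))"
  by (auto simp: Sym_def sym_incl_def FactRing_def A_RCOSETS_def' cpoly_var_in)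

lemma sym_const_in:
  "sym_const fun_scale (dual_space s W) c \<in> carrier (Sym fun_scale (dual_space s W))"
  by (auto simp: Sym_def sym_const_def FactRing_def A_RCOSETS_def' cpoly_const_in)

lemma coord_functional_in: "i \<in> {1..N} \<Longrightarrow> coord_functional N i \<in> F_dual N"
  by (auto simp: dual_space_def coord_functional_def coord_space_def fun_scale_def)

lemma ideal_squares: "ideal (squares_ideal N) (Sym_F_dual N)"
proof -
  interpret R: cring "Sym_F_dual N" by (rule cring_Sym_dual)
  show ?thesis
    unfolding squares_ideal_def
    by (rule R.genideal_ideal) (auto intro!: R.nat_pow_closed sym_incl_in coord_functional_in)
qed

lemma cring_Phi: "cring (Phi N)"
  unfolding Phi_def by (intro ideal.quotient_is_cring ideal_squares cring_Sym_dual)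

lemma p_dual_in:
  assumes "vector_space s" "l \<in> E_dual s"
  shows "p_dual s N v l \<in> F_dual N"
proof -
  interpret vector_space s by fact
  have add: "p_map s N v (\<lambda>i. x i + y i) = p_map s N v x + p_map s N v y" for x y
    by (simp add: p_map_def scale_left_distrib sum.distrib)
  have scale: "p_map s N v (\<lambda>i. c * x i) = s c (p_map s N v x)" for c x
    by (simp add: p_map_def scale_sum_right)
  have l: "l (a + b) = l a + l b" "l (s c a) = c * l a" for a b c
    using assms(2) by (auto simp: dual_space_def)
  show ?thesis
    by (auto simp: dual_space_def p_dual_def coord_space_def fun_scale_def plus_fun_def add scale l)
qed

lemma phi_incl_in: "f \<in> F_dual N \<Longrightarrow> phi_incl N f \<in> carrier (Phi N)"
  by (auto simp: Phi_def phi_incl_def FactRing_def A_RCOSETS_def' intro: sym_incl_in)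

lemma phi_const_in: "phi_const N c \<in> carrier (Phi N)"
  by (auto simp: Phi_def phi_const_def FactRing_def A_RCOSETS_def' intro: sym_const_in)

lemma subring_C_alg:
  assumes "vector_space s"
  shows "subring (carrier (C_alg s N v)) (Phi N)"
proof -
  interpret R: cring "Phi N" by (rule cring_Phi)
  show ?thesis
    unfolding C_alg_def
    by (simp, intro R.generate_ring_is_subring)
       (auto intro: phi_incl_in phi_const_in p_dual_in assms)
qed

lemma ideal_I:
  "ideal (I_ideal s N v) (Sym_E_dual s)"
proof -
  interpret R: cring "Sym_E_dual s" by (rule cring_Sym_dual)
  show ?thesis
    unfolding I_ideal_def
    by (rule R.genideal_ideal)
       (auto intro!: R.nat_pow_closed R.m_closed sym_incl_in simp: essential_vector_def)
qed

end

theory Submission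
  imports Defs "HOL-Computational_Algebra.Polynomial"
begin

text \<open>
  Restricting to square-free monomials, the coefficients of the image of \<open>q \<in> Sym(E\<^sup>*)\<close> in \<open>\<Phi>\<^sub>N\<close>
  are the mixed derivatives of \<open>q\<close> at \<open>0\<close> along subfamilies of \<open>V\<close>. To see that \<open>\<I>\<^sub>V\<close> contains
  every \<open>q\<close> for which they all vanish, induct on \<open>V\<close>, removing a vector \<open>v \<noteq> 0\<close>. If \<open>V - v\<close> still
  spans \<open>E\<close>, then \<open>\<partial>\<^sub>v q\<close> lies in the kernel for \<open>V - v\<close>, and \<open>\<partial>\<^sub>v\<close> maps the ideal of \<open>V\<close> onto the
  ideal of \<open>V - v\<close>; so after subtracting an element of \<open>\<I>\<^sub>V\<close> we may assume \<open>\<partial>\<^sub>v q = 0\<close>, which means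
  that \<open>q\<close> lives on \<open>E / v\<close>, where the contracted family \<open>V / v\<close> is shorter. If \<open>V - v\<close> spans only
  a hyperplane \<open>\<lambda> = 0\<close>, then \<open>\<lambda>\<^sup>2 \<in> \<I>\<^sub>V\<close> and \<open>q = q\<^sub>0 + \<lambda> q\<^sub>1\<close> modulo \<open>\<lambda>\<^sup>2\<close>, with both \<open>q\<^sub>0\<close> and \<open>q\<^sub>1\<close>
  in the kernel for \<open>V / v\<close>.
\<close>

section \<open>Evaluation of polynomials\<close>

lemma update_eq_add_single:
  "k \<notin> Poly_Mapping.keys f \<Longrightarrow> Poly_Mapping.update k c f = f + Poly_Mapping.single k (c :: 'b::comm_monoid_add)"
  by (rule poly_mapping_eqI) (auto simp: lookup_update lookup_add lookup_single when_def in_keys_iff)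

lemma cpoly_var_power: "cpoly_var w ^ k = Poly_Mapping.single (Poly_Mapping.single w k) 1"
  by (induction k) (auto simp: cpoly_var_def mult_single single_add[symmetric] simp flip: single_one)

lemma cpoly_const_add: "cpoly_const (c + d) = cpoly_const c + cpoly_const d"
  by (simp add: cpoly_const_def single_add)

lemma cpoly_const_mult: "cpoly_const (c * d) = cpoly_const c * cpoly_const d"
  by (simp add: cpoly_const_def mult_single)

lemma cpoly_const_0 [simp]: "cpoly_const 0 = 0"
  by (simp add: cpoly_const_def)

lemma cpoly_const_1 [simp]: "cpoly_const 1 = 1"
  by (simp add: cpoly_const_def)

lemma cpoly_one_in: "1 \<in> carrier (cpoly_ring W)"
  using cpoly_const_in[of 1] by simp

lemma cpoly_zero_in: "0 \<in> carrier (cpoly_ring W)"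
  using cpoly_const_in[of 0] by simp

lemma cpoly_power_in: "q \<in> carrier (cpoly_ring W) \<Longrightarrow> q ^ k \<in> carrier (cpoly_ring W)"
  by (induction k) (auto intro: cpoly_one_in cpoly_mult_in)

lemma cpoly_sum_in:
  "(\<And>i. i \<in> A \<Longrightarrow> f i \<in> carrier (cpoly_ring W)) \<Longrightarrow> sum f A \<in> carrier (cpoly_ring W)"
  by (induction A rule: infinite_finite_induct) (auto intro: cpoly_zero_in cpoly_add_in)

lemmas cpoly_in = cpoly_one_in cpoly_zero_in cpoly_const_in cpoly_var_in cpoly_add_in cpoly_diff_in
  cpoly_mult_in cpoly_uminus_in cpoly_power_in cpoly_sum_in

lemma cpoly_mono: "W \<subseteq> W' \<Longrightarrow> q \<in> carrier (cpoly_ring W) \<Longrightarrow> q \<in> carrier (cpoly_ring W')"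
  unfolding cpoly_carrier by blast

text \<open>Two nested inductions on finite support: monomials arise as products of powers of
  variables, and polynomials as sums of scalar multiples of monomials.\<close>

lemma cpoly_induct [consumes 1, case_names const var add mult]:
  assumes q: "q \<in> carrier (cpoly_ring W)"
    and scalar: "\<And>c. P (cpoly_const c)"
    and var: "\<And>w. w \<in> W \<Longrightarrow> P (cpoly_var w)"
    and add: "\<And>p r. p \<in> carrier (cpoly_ring W) \<Longrightarrow> r \<in> carrier (cpoly_ring W) \<Longrightarrow> P p \<Longrightarrow> P r \<Longrightarrow> P (p + r)"
    and mult: "\<And>p r. p \<in> carrier (cpoly_ring W) \<Longrightarrow> r \<in> carrier (cpoly_ring W) \<Longrightarrow> P p \<Longrightarrow> P r \<Longrightarrow> P (p * r)"
  shows "P q"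
proof -
  have pow: "P (cpoly_var w ^ k)" if "w \<in> W" for w k
  proof (induction k)
    case 0 then show ?case using scalar[of 1] by simp
  next
    case (Suc k) then show ?case using that by (auto intro!: mult var cpoly_in)
  qed
  have mono: "P (Poly_Mapping.single m 1)" if "Poly_Mapping.keys m \<subseteq> W" for m
    using that
  proof (induction m rule: update_induct)
    case const then show ?case using scalar[of 1] by simp
  next
    case (update m w k)
    have sub: "Poly_Mapping.keys m \<subseteq> W" "w \<in> W"
      using update by (auto simp: keys_update split: if_splits)
    have "Poly_Mapping.single (Poly_Mapping.update w k m) 1 = Poly_Mapping.single m (1::complex) * cpoly_var w ^ k"
      using update by (simp add: update_eq_add_single cpoly_var_power mult_single)
    moreover have "Poly_Mapping.single m (1::complex) \<in> carrier (cpoly_ring W)"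
      using sub by (simp add: cpoly_carrier)
    ultimately show ?case using sub update pow by (auto intro!: mult cpoly_in)
  qed
  show ?thesis using q
  proof (induction q rule: update_induct)
    case const then show ?case using scalar[of 0] by simp
  next
    case (update q m c)
    have sub: "q \<in> carrier (cpoly_ring W)" "Poly_Mapping.keys m \<subseteq> W"
      using update by (auto simp: cpoly_carrier keys_update split: if_splits)
    have eq: "Poly_Mapping.update m c q = q + cpoly_const c * Poly_Mapping.single m 1"
      using update by (simp add: update_eq_add_single cpoly_const_def mult_single)
    have m: "Poly_Mapping.single m (1::complex) \<in> carrier (cpoly_ring W)"
      using sub by (simp add: cpoly_carrier)
    show ?case unfolding eq
      using sub update m by (intro add mult mono scalar cpoly_in) auto
  qed
qed

lemma cpoly_induct_UNIV [case_names const var add mult]: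
  assumes "\<And>c. P (cpoly_const c)" "\<And>w. P (cpoly_var w)"
    "\<And>p r. P p \<Longrightarrow> P r \<Longrightarrow> P (p + r)" "\<And>p r. P p \<Longrightarrow> P r \<Longrightarrow> P (p * r)"
  shows "P q"
  by (rule cpoly_induct[of q UNIV]) (auto simp: cpoly_carrier intro: assms)

text \<open>The scalar map \<open>h\<close> is a parameter so that the same construction serves for
  numerical evaluation (\<open>h\<close> the identity) and for substitution into another polynomial
  ring (\<open>h\<close> equal to \<open>cpoly_const\<close>).\<close>

definition cpoly_eval :: "(complex \<Rightarrow> 'b::comm_ring_1) \<Rightarrow> ('w \<Rightarrow> 'b) \<Rightarrow> 'w cpoly \<Rightarrow> 'b" where
  "cpoly_eval h a q = (\<Sum>m\<in>Poly_Mapping.keys q. h (Poly_Mapping.lookup q m) *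
     (\<Prod>w\<in>Poly_Mapping.keys m. a w ^ Poly_Mapping.lookup m w))"

locale scalar_hom =
  fixes h :: "complex \<Rightarrow> 'b::comm_ring_1"
  assumes hom_0: "h 0 = 0" and hom_1: "h 1 = 1"
    and hom_add: "h (x + y) = h x + h y" and hom_mult: "h (x * y) = h x * h y"
begin

lemma eval_add: "cpoly_eval h a (p + q) = cpoly_eval h a p + cpoly_eval h a q"
  unfolding cpoly_eval_def
  by (rule setsum_keys_plus_distrib) (auto simp: hom_0 hom_add distrib_right)

lemma eval_single:
  "cpoly_eval h a (Poly_Mapping.single m c) = h c * (\<Prod>w\<in>Poly_Mapping.keys m. a w ^ Poly_Mapping.lookup m w)"
  by (simp add: cpoly_eval_def hom_0)

lemma eval_const: "cpoly_eval h a (cpoly_const c) = h c"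
  by (simp add: cpoly_const_def eval_single)

lemma eval_var: "cpoly_eval h a (cpoly_var w) = a w"
  by (simp add: cpoly_var_def eval_single hom_1)

text \<open>Both products extend to the union of the two supports, because the extra factors have
  exponent 0; there the exponents simply add.\<close>

lemma monomial_add:
  fixes a :: "'w \<Rightarrow> 'b"
  shows "(\<Prod>w\<in>Poly_Mapping.keys (m + n). a w ^ Poly_Mapping.lookup (m + n) w) =
    (\<Prod>w\<in>Poly_Mapping.keys m. a w ^ Poly_Mapping.lookup m w) *
    (\<Prod>w\<in>Poly_Mapping.keys n. a w ^ Poly_Mapping.lookup n w)"
proof -
  let ?A = "Poly_Mapping.keys m \<union> Poly_Mapping.keys n"
  have *: "(\<Prod>w\<in>Poly_Mapping.keys k. a w ^ Poly_Mapping.lookup k w) =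
      (\<Prod>w\<in>?A. a w ^ Poly_Mapping.lookup k w)" if "Poly_Mapping.keys k \<subseteq> ?A" for k
    by (rule prod.mono_neutral_left) (use that in \<open>auto simp: in_keys_iff\<close>)
  show ?thesis
    unfolding *[OF Poly_Mapping.keys_add] *[OF Un_upper1] *[OF Un_upper2]
    by (simp add: lookup_add power_add prod.distrib)
qed

lemma eval_mult: "cpoly_eval h a (p * q) = cpoly_eval h a p * cpoly_eval h a q"
proof (induction p rule: update_induct)
  case const then show ?case by (simp add: cpoly_eval_def)
next
  case (update p m c)
  have "cpoly_eval h a (Poly_Mapping.single m c * q) = cpoly_eval h a (Poly_Mapping.single m c) * cpoly_eval h a q"
  proof (induction q rule: update_induct)
    case const then show ?case by (simp add: cpoly_eval_def)
  next
    case (update q n d)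
    then show ?case
      by (simp add: update_eq_add_single distrib_left eval_add mult_single eval_single hom_mult
          monomial_add mult_ac)
  qed
  then show ?case using update
    by (simp add: update_eq_add_single distrib_right eval_add)
qed

lemma eval_one: "cpoly_eval h a 1 = 1"
  using eval_const[of a 1] by (simp add: hom_1)

lemma eval_power: "cpoly_eval h a (p ^ k) = cpoly_eval h a p ^ k"
  by (induction k) (simp_all add: eval_one eval_mult)

lemma eval_uminus: "cpoly_eval h a (- p) = - cpoly_eval h a p"
  using eval_add[of a p "- p"] by (simp add: cpoly_eval_def add_eq_0_iff2)

lemma eval_diff: "cpoly_eval h a (p - q) = cpoly_eval h a p - cpoly_eval h a q"
  using eval_add[of a p "- q"] eval_uminus[of a q] by simp

lemma eval_zero: "cpoly_eval h a 0 = 0"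
  by (simp add: cpoly_eval_def)

lemma eval_sum: "cpoly_eval h a (sum f A) = (\<Sum>i\<in>A. cpoly_eval h a (f i))"
  by (induction A rule: infinite_finite_induct) (auto simp: eval_add eval_zero)

lemmas eval_simps = eval_add eval_const eval_var eval_mult eval_power eval_uminus eval_diff
  eval_zero eval_one eval_sum

end

global_interpretation complex_eval: scalar_hom "\<lambda>c::complex. c"
  by unfold_locales auto

global_interpretation cpoly_subst: scalar_hom "cpoly_const :: complex \<Rightarrow> 'w cpoly"
  by unfold_locales (auto simp: cpoly_const_add cpoly_const_mult)

section \<open>Polynomial functions and directional derivatives\<close>

inductive_set polyfun :: "(complex \<Rightarrow> 'e::ab_group_add \<Rightarrow> 'e) \<Rightarrow> ('e \<Rightarrow> complex) set" for s where
  const: "(\<lambda>x. c) \<in> polyfun s"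
| functional: "l \<in> E_dual s \<Longrightarrow> l \<in> polyfun s"
| add: "f \<in> polyfun s \<Longrightarrow> g \<in> polyfun s \<Longrightarrow> (\<lambda>x. f x + g x) \<in> polyfun s"
| mult: "f \<in> polyfun s \<Longrightarrow> g \<in> polyfun s \<Longrightarrow> (\<lambda>x. f x * g x) \<in> polyfun s"

text \<open>An analytic derivative of the function is taken rather than a formal one of a
  polynomial: it depends only on the class in Sym, since congruent polynomials define the same
  function. On \<open>polyfun s\<close> the derivative exists, so \<open>THE\<close> picks it
  out.\<close>

definition dirderiv ::
    "(complex \<Rightarrow> 'e::ab_group_add \<Rightarrow> 'e) \<Rightarrow> 'e \<Rightarrow> ('e \<Rightarrow> complex) \<Rightarrow> 'e \<Rightarrow> complex" where
  "dirderiv s v f x = (THE d. ((\<lambda>t. f (x + s t v)) has_field_derivative d) (at 0))"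

text \<open>The coefficient of a square-free monomial in the image of \<open>f\<close> in \<open>\<Phi>\<^sub>N\<close> is the mixed
  derivative of \<open>f\<close> at \<open>0\<close> along the corresponding vectors, so this predicate describes the kernel.\<close>

fun squarefree_vanishing ::
    "(complex \<Rightarrow> 'e::ab_group_add \<Rightarrow> 'e) \<Rightarrow> 'e list \<Rightarrow> ('e \<Rightarrow> complex) \<Rightarrow> bool" where
  "squarefree_vanishing s [] f \<longleftrightarrow> f 0 = 0"
| "squarefree_vanishing s (v # vs) f \<longleftrightarrow>
     squarefree_vanishing s vs f \<and> squarefree_vanishing s vs (dirderiv s v f)"

lemma dirderiv_eqI:
  "((\<lambda>t. f (x + s t v)) has_field_derivative d) (at 0) \<Longrightarrow> dirderiv s v f x = d"
  unfolding dirderiv_def by (rule the_equality) (auto intro: DERIV_unique)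

locale complex_space = vector_space s for s :: "complex \<Rightarrow> 'e::ab_group_add \<Rightarrow> 'e"
begin

lemma functional_simps:
  assumes "l \<in> E_dual s"
  shows "l (x + y) = l x + l y" "l (s c x) = c * l x" "l 0 = 0"
proof -
  show 1: "l (x + y) = l x + l y" and "l (s c x) = c * l x" for x y
    using assms by (auto simp: dual_space_def)
  show "l 0 = 0" using 1[of 0 0] by simp
qed

lemma functional_span:
  assumes "l \<in> E_dual s" "\<And>x. x \<in> S \<Longrightarrow> l x = 0" "x \<in> span S"
  shows "l x = 0"
  using assms(3) by (induction rule: span_induct_alt) (auto simp: functional_simps[OF assms(1)] assms(2))

text \<open>A basis of \<open>span S\<close> together with \<open>v\<close> is independent and
  extends to a basis of the whole space; the coordinate along \<open>v\<close> is the functional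
  sought.\<close>

lemma ex_functional:
  assumes "v \<notin> span S"
  shows "\<exists>l\<in>E_dual s. l v = 1 \<and> (\<forall>x\<in>S. l x = 0)"
proof -
  obtain B where B: "B \<subseteq> span S" "independent B" "span S \<subseteq> span B"
    using basis_exists[of "span S"] by metis
  have vB: "v \<notin> span B"
    using assms subsetD[OF span_minimal[OF B(1) subspace_span], of v] by metis
  have ind: "independent (insert v B)"
    using B(2) vB by (simp add: independent_insertI)
  define C where "C = extend_basis (insert v B)"
  have C: "insert v B \<subseteq> C" "independent C" "span C = UNIV"
    unfolding C_def
    using extend_basis_superset[OF ind] independent_extend_basis[OF ind] span_extend_basis[OF ind] by auto
  define l where "l = (\<lambda>x. representation C x v)"
  have l: "l \<in> E_dual s"
    using C by (auto simp: dual_space_def l_def representation_add representation_scale)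
  have v: "l v = 1"
    using C by (simp add: l_def representation_basis)
  have lB: "l b = 0" if "b \<in> B" for b
  proof -
    have "b \<noteq> v" using that vB span_base by blast
    then show ?thesis using C that by (auto simp: l_def representation_basis)
  qed
  have "l x = 0" if "x \<in> S" for x
    by (rule functional_span[OF l lB, of B]) (use that B span_base in \<open>blast+\<close>)
  with l v show ?thesis by blast
qed

text \<open>Existence has to precede any use of \<open>dirderiv\<close>. Proving in the same
  induction that the derivative is polynomial makes repeated differentiation possible.\<close>

lemma polyfun_ex_derivative:
  assumes "f \<in> polyfun s"
  shows "\<exists>g\<in>polyfun s. \<forall>x. ((\<lambda>t. f (x + s t v)) has_field_derivative g x) (at 0)"
  using assms
proof induction
  case (const c)
  show ?case by (rule bexI[of _ "\<lambda>x. 0"]) (auto intro: polyfun.const)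
next
  case (functional l)
  show ?case
    by (rule bexI[of _ "\<lambda>x. l v"])
       (auto intro!: polyfun.const derivative_eq_intros simp: functional_simps[OF functional])
next
  case (add f g)
  then obtain f' g' where "f' \<in> polyfun s" "g' \<in> polyfun s"
    "\<And>x. ((\<lambda>t. f (x + s t v)) has_field_derivative f' x) (at 0)"
    "\<And>x. ((\<lambda>t. g (x + s t v)) has_field_derivative g' x) (at 0)" by blast
  then show ?case
    by (intro bexI[of _ "\<lambda>x. f' x + g' x"]) (auto intro!: polyfun.add derivative_eq_intros)
next
  case (mult f g)
  then obtain f' g' where "f' \<in> polyfun s" "g' \<in> polyfun s"
    "\<And>x. ((\<lambda>t. f (x + s t v)) has_field_derivative f' x) (at 0)"
    "\<And>x. ((\<lambda>t. g (x + s t v)) has_field_derivative g' x) (at 0)" by blast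
  with mult.hyps show ?case
    by (intro bexI[of _ "\<lambda>x. f' x * g x + f x * g' x"])
       (auto intro!: polyfun.add polyfun.mult derivative_eq_intros)
qed

lemma dirderiv_polyfun: "f \<in> polyfun s \<Longrightarrow> dirderiv s v f \<in> polyfun s"
  using polyfun_ex_derivative[of f v] dirderiv_eqI[of f _ s v] by (metis ext)

lemma has_dirderiv:
  "f \<in> polyfun s \<Longrightarrow> ((\<lambda>t. f (x + s t v)) has_field_derivative dirderiv s v f x) (at 0)"
  using polyfun_ex_derivative[of f v] dirderiv_eqI[of f x s v] by metis

lemma dirderiv_const: "dirderiv s v (\<lambda>x. c) = (\<lambda>x. 0)"
  by (intro ext dirderiv_eqI) auto

lemma dirderiv_functional: "l \<in> E_dual s \<Longrightarrow> dirderiv s v l = (\<lambda>x. l v)"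
  by (intro ext dirderiv_eqI) (auto intro!: derivative_eq_intros simp: functional_simps)

lemma dirderiv_add:
  assumes "f \<in> polyfun s" "g \<in> polyfun s"
  shows "dirderiv s v (\<lambda>x. f x + g x) = (\<lambda>x. dirderiv s v f x + dirderiv s v g x)"
  using has_dirderiv[OF assms(1)] has_dirderiv[OF assms(2)]
  by (intro ext dirderiv_eqI) (auto intro!: derivative_eq_intros)

lemma dirderiv_mult:
  assumes "f \<in> polyfun s" "g \<in> polyfun s"
  shows "dirderiv s v (\<lambda>x. f x * g x) = (\<lambda>x. dirderiv s v f x * g x + f x * dirderiv s v g x)"
proof (intro ext dirderiv_eqI)
  fix x
  show "((\<lambda>t. f (x + s t v) * g (x + s t v)) has_field_derivative
      dirderiv s v f x * g x + f x * dirderiv s v g x) (at 0)"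
    using DERIV_mult[OF has_dirderiv[OF assms(1)] has_dirderiv[OF assms(2)], of x v x v]
    by (simp add: mult_ac add_ac)
qed

lemma polyfun_diff: "f \<in> polyfun s \<Longrightarrow> g \<in> polyfun s \<Longrightarrow> (\<lambda>x. f x - g x) \<in> polyfun s"
  using polyfun.add[OF _ polyfun.mult[OF polyfun.const[of "-1"]], of f s g] by simp

lemma polyfun_power: "f \<in> polyfun s \<Longrightarrow> (\<lambda>x. f x ^ k) \<in> polyfun s"
  by (induction k) (auto intro: polyfun.const polyfun.mult)

lemma vanishing_zero: "squarefree_vanishing s vs (\<lambda>x. 0)"
  by (induction vs) (auto simp: dirderiv_const)

lemma vanishing_add:
  "f \<in> polyfun s \<Longrightarrow> g \<in> polyfun s \<Longrightarrow> squarefree_vanishing s vs f \<Longrightarrow> squarefree_vanishing s vs g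
    \<Longrightarrow> squarefree_vanishing s vs (\<lambda>x. f x + g x)"
  by (induction vs arbitrary: f g) (auto simp: dirderiv_add dirderiv_polyfun)

text \<open>By the Leibniz rule the derivative of \<open>f * g\<close> is a combination of
  \<open>f\<close> and its derivative, and both satisfy the condition for the shorter list. With
  \<open>vanishing_add\<close> this makes the condition an ideal property.\<close>

lemma vanishing_mult:
  "f \<in> polyfun s \<Longrightarrow> g \<in> polyfun s \<Longrightarrow> squarefree_vanishing s vs f
    \<Longrightarrow> squarefree_vanishing s vs (\<lambda>x. f x * g x)"
  by (induction vs arbitrary: f g)
     (auto simp: dirderiv_mult intro!: vanishing_add polyfun.mult intro: dirderiv_polyfun)

lemma vanishing_diff:
  assumes "f \<in> polyfun s" "g \<in> polyfun s" "squarefree_vanishing s vs f" "squarefree_vanishing s vs g"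
  shows "squarefree_vanishing s vs (\<lambda>x. f x - g x)"
  using vanishing_add[OF assms(1) polyfun.mult[OF assms(2) polyfun.const[of "-1"]] assms(3)
      vanishing_mult[OF assms(2) polyfun.const assms(4)]] by simp

text \<open>Differentiation along \<open>u\<close> kills a power of \<open>l\<close> when
  \<open>l u = 0\<close> and otherwise lowers its exponent by one. At most \<open>k\<close> vectors
  are of the second sort, so a factor \<open>l\<close> always survives and vanishes at 0.\<close>

lemma vanishing_functional_power:
  assumes l: "l \<in> E_dual s"
  shows "length (filter (\<lambda>u. l u \<noteq> 0) vs) \<le> k \<Longrightarrow> squarefree_vanishing s vs (\<lambda>x. l x ^ Suc k)"
proof (induction vs arbitrary: k)
  case Nil
  then show ?case by (simp add: functional_simps[OF l])
next
  case (Cons v vs)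
  have pow: "y * y ^ (j - Suc 0) = y ^ j" if "0 < j" for y :: complex and j
    using that by (cases j) auto
  have D: "dirderiv s v (\<lambda>x. l x ^ Suc k) = (\<lambda>x. l x ^ k * (of_nat (Suc k) * l v))"
    by (intro ext dirderiv_eqI)
       (cases k; auto intro!: derivative_eq_intros simp: functional_simps[OF l] algebra_simps pow)
  show ?case
  proof (cases "l v = 0")
    case True
    with Cons show ?thesis by (simp add: D vanishing_zero del: power_Suc)
  next
    case False
    \<comment> \<open>The head is itself counted by the filter, so \<open>k\<close> is positive and
      the tail satisfies the bound for \<open>k - 1\<close>.\<close>
    then obtain j where k: "k = Suc j" using Cons.prems by (cases k) auto
    have "squarefree_vanishing s vs (\<lambda>x. l x ^ k)"
      using Cons.IH[of j] Cons.prems False by (simp add: k del: power_Suc)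
    then have "squarefree_vanishing s vs (dirderiv s v (\<lambda>x. l x ^ Suc k))"
      unfolding D by (intro vanishing_mult polyfun_power polyfun.const polyfun.functional[OF l])
    moreover have "squarefree_vanishing s vs (\<lambda>x. l x ^ Suc k)"
      using Cons.IH[of k] Cons.prems False by (simp del: power_Suc)
    ultimately show ?thesis by simp
  qed
qed

end

section \<open>Congruence modulo the linear relations\<close>

lemma ideal_cpoly:
  assumes "ideal I (cpoly_ring W)"
  shows "I \<subseteq> carrier (cpoly_ring W)" "0 \<in> I" "p \<in> I \<Longrightarrow> q \<in> I \<Longrightarrow> p + q \<in> I"
    "q \<in> carrier (cpoly_ring W) \<Longrightarrow> p \<in> I \<Longrightarrow> q * p \<in> I"
    "p \<in> I \<Longrightarrow> - p \<in> I" "p \<in> I \<Longrightarrow> q \<in> I \<Longrightarrow> p - q \<in> I"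
proof -
  interpret ideal I "cpoly_ring W" by fact
  show "I \<subseteq> carrier (cpoly_ring W)" by (rule a_subset)
  show "0 \<in> I" using additive_subgroup.zero_closed[OF ideal.axioms(1)[OF assms]] by (simp add: cpoly_ops)
  show *: "p + q \<in> I" if "p \<in> I" "q \<in> I" for p q using additive_subgroup.a_closed[OF ideal.axioms(1)[OF assms] that] by (simp add: cpoly_ops)
  show **: "q * p \<in> I" if "q \<in> carrier (cpoly_ring W)" "p \<in> I" for p q
    using I_l_closed[OF that(2,1)] by (simp add: cpoly_ops)
  show ***: "- p \<in> I" if "p \<in> I" for p
    using **[OF cpoly_uminus_in[OF cpoly_one_in] that] by simp
  show "p - q \<in> I" if "p \<in> I" "q \<in> I" for p q
    using *[OF that(1) ***[OF that(2)]] by simp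
qed

lemmas sym_ideal_simps = ideal_cpoly[OF ideal_sym_dual]

lemma ideal_cpoly_mult:
  assumes I: "ideal I (cpoly_ring W)" and "p - p' \<in> I" "q - q' \<in> I"
    and "p \<in> carrier (cpoly_ring W)" "q' \<in> carrier (cpoly_ring W)"
  shows "p * q - p' * q' \<in> I"
proof -
  have "p * q - p' * q' = p * (q - q') + q' * (p - p')" by (simp add: algebra_simps)
  then show ?thesis using assms by (simp add: ideal_cpoly[OF I])
qed

lemma sym_relations_mem_ideal:
  "sym_relations fun_scale (dual_space s W) \<subseteq> sym_ideal fun_scale (dual_space s W)"
  unfolding sym_ideal_def
  by (intro ring.genideal_self cring.axioms(1) cring_cpoly sym_relations_in
        dual_space_add dual_space_scale)

lemma var_add_congr:
  assumes "f \<in> dual_space s W" "g \<in> dual_space s W"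
  shows "cpoly_var (f + g) - (cpoly_var f + cpoly_var g) \<in> sym_ideal fun_scale (dual_space s W)"
  using sym_relations_mem_ideal[of s W] assms unfolding sym_relations_def by blast

lemma var_scale_congr:
  assumes "f \<in> dual_space s W"
  shows "cpoly_var (fun_scale c f) - cpoly_const c * cpoly_var f \<in> sym_ideal fun_scale (dual_space s W)"
  using sym_relations_mem_ideal[of s W] assms unfolding sym_relations_def by blast

text \<open>The polynomial \<open>cpoly_var 0\<close> is a genuine variable, indexed by the zero
  functional; the relation for scaling by 0 is what kills it in Sym.\<close>

lemma var_zero_congr:
  fixes W :: "'w::ab_group_add set"
  shows "cpoly_var 0 \<in> sym_ideal fun_scale (dual_space s W)"
proof -
  have "(0 :: 'w \<Rightarrow> complex) \<in> dual_space s W" "fun_scale 0 0 = (0 :: 'w \<Rightarrow> complex)"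
    by (auto simp: dual_space_def fun_scale_def)
  then show ?thesis using var_scale_congr[of 0 s W 0] by simp
qed

lemma sym_ideal_minimal:
  assumes "ideal I (cpoly_ring (dual_space s W))"
    and "\<And>f g. f \<in> dual_space s W \<Longrightarrow> g \<in> dual_space s W \<Longrightarrow> cpoly_var (f + g) - (cpoly_var f + cpoly_var g) \<in> I"
    and "\<And>c f. f \<in> dual_space s W \<Longrightarrow> cpoly_var (fun_scale c f) - cpoly_const c * cpoly_var f \<in> I"
  shows "sym_ideal fun_scale (dual_space s W) \<subseteq> I"
  unfolding sym_ideal_def
  by (rule ring.genideal_minimal[OF cring.axioms(1)[OF cring_cpoly] assms(1)])
     (use assms(2,3) in \<open>auto simp: sym_relations_def\<close>)

abbreviation poly_fun :: "'e cpoly \<Rightarrow> ('e \<Rightarrow> complex) \<Rightarrow> complex" where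
  "poly_fun q a \<equiv> cpoly_eval (\<lambda>c. c) a q"

lemma idealI_cpoly:
  assumes "I \<subseteq> carrier (cpoly_ring W)" "0 \<in> I" "\<And>p q. p \<in> I \<Longrightarrow> q \<in> I \<Longrightarrow> p + q \<in> I"
    "\<And>p q. q \<in> carrier (cpoly_ring W) \<Longrightarrow> p \<in> I \<Longrightarrow> q * p \<in> I"
  shows "ideal I (cpoly_ring W)"
proof -
  interpret cring "cpoly_ring W" by (rule cring_cpoly)
  have neg: "\<ominus>\<^bsub>cpoly_ring W\<^esub> p = - p" if "p \<in> carrier (cpoly_ring W)" for p
    by (rule sum_zero_eq_neg[symmetric]) (use that in \<open>auto simp: cpoly_ops cpoly_in\<close>)
  have "- p \<in> I" if "p \<in> I" for p
    using assms(4)[OF cpoly_uminus_in[OF cpoly_one_in] that] by simp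
  moreover have "inv\<^bsub>add_monoid (cpoly_ring W)\<^esub> p = - p" if "p \<in> I" for p
    using neg[of p] that assms(1) by (auto simp: a_inv_def)
  ultimately have "subgroup I (add_monoid (cpoly_ring W))"
    using assms by (intro group.subgroupI add.is_group) (auto simp: cpoly_ops)
  moreover have "p * q \<in> I" if "q \<in> carrier (cpoly_ring W)" "p \<in> I" for p q
    using assms(4)[OF that] by (simp add: mult.commute)
  ultimately show ?thesis
    using assms(4) by (intro idealI ring_axioms) (auto simp: cpoly_ops)
qed

text \<open>Evaluation is well defined on Sym: an assignment of the variables that is linear on the
  dual space respects all defining relations, and the polynomials killed by such assignments form an
  ideal.\<close>

lemma ideal_poly_fun_zero:
  assumes "\<And>a. a \<in> A \<Longrightarrow> (\<forall>f\<in>dual_space s W. \<forall>g\<in>dual_space s W. a (f + g) = a f + a g) \<and>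
     (\<forall>c. \<forall>f\<in>dual_space s W. a (fun_scale c f) = c * a f)"
    and "q \<in> sym_ideal fun_scale (dual_space s W)" "a \<in> A"
  shows "poly_fun q a = 0"
proof -
  have "sym_ideal fun_scale (dual_space s W) \<subseteq>
      {q \<in> carrier (cpoly_ring (dual_space s W)). \<forall>a\<in>A. poly_fun q a = 0}"
    by (intro sym_ideal_minimal idealI_cpoly)
       (auto simp: complex_eval.eval_simps assms(1) cpoly_in dual_space_add dual_space_scale)
  then show ?thesis using assms(2,3) by blast
qed

section \<open>Functionals vanishing on a set\<close>

text \<open>This is the dual of the quotient of \<open>E\<close> by the span of \<open>L\<close>,
  kept inside \<open>E_dual s\<close>, so that contraction changes neither the type nor the ambient
  polynomial ring.\<close>

definition annihilator :: "(complex \<Rightarrow> 'e::ab_group_add \<Rightarrow> 'e) \<Rightarrow> 'e set \<Rightarrow> ('e \<Rightarrow> complex) set" where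
  "annihilator s L = {l \<in> E_dual s. \<forall>x\<in>L. l x = 0}"

section \<open>Evaluation on \<open>E\<close>, and splitting off one variable\<close>

context complex_space begin

abbreviation "ev q x \<equiv> poly_fun q (\<lambda>l. l x)"
abbreviation "Z \<equiv> sym_ideal fun_scale (E_dual s)"
abbreviation "C L \<equiv> carrier (cpoly_ring (annihilator s L))"

lemma C_subset: "q \<in> C L \<Longrightarrow> q \<in> carrier (cpoly_ring (E_dual s))"
  by (rule cpoly_mono[of "annihilator s L"]) (auto simp: annihilator_def)

lemma C_anti: "L \<subseteq> L' \<Longrightarrow> q \<in> C L' \<Longrightarrow> q \<in> C L"
  by (rule cpoly_mono[of "annihilator s L'"]) (auto simp: annihilator_def)

lemma ev_sym_ideal: "q \<in> Z \<Longrightarrow> ev q x = 0"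
  by (rule ideal_poly_fun_zero[of "{\<lambda>l. l x}"]) (auto simp: fun_scale_def)

lemma ev_congr: "p - q \<in> Z \<Longrightarrow> ev p x = ev q x"
  using ev_sym_ideal[of "p - q" x] by (simp add: complex_eval.eval_diff)

lemma ev_polyfun: "q \<in> carrier (cpoly_ring (E_dual s)) \<Longrightarrow> ev q \<in> polyfun s"
  by (induction q rule: cpoly_induct)
     (auto simp: complex_eval.eval_simps intro: polyfun.intros)

lemma ev_translate:
  assumes "q \<in> C L" "v \<in> L"
  shows "ev q (x + s t v) = ev q x"
  using assms
  by (induction q rule: cpoly_induct)
     (auto simp: complex_eval.eval_simps annihilator_def functional_simps)

text \<open>The derivative is only a function; an induction hypothesis about polynomials applies to
  it once it has a polynomial representative that again involves only functionals vanishing on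
  \<open>L\<close>.\<close>

lemma ev_dirderiv:
  assumes "q \<in> C L"
  shows "\<exists>r\<in>C L. dirderiv s v (ev q) = ev r"
  using assms
proof (induction q rule: cpoly_induct)
  case (const c)
  show ?case by (rule bexI[of _ 0]) (auto simp: complex_eval.eval_simps dirderiv_const cpoly_in)
next
  case (var l)
  then show ?case
    by (intro bexI[of _ "cpoly_const (l v)"])
       (auto simp: complex_eval.eval_simps dirderiv_functional cpoly_in annihilator_def)
next
  case (add p q)
  then obtain p' q' where "p' \<in> C L" "q' \<in> C L" "dirderiv s v (ev p) = ev p'" "dirderiv s v (ev q) = ev q'"
    by blast
  with dirderiv_add[OF ev_polyfun[OF C_subset] ev_polyfun[OF C_subset], OF add.hyps, of v]
  show ?case
    by (intro bexI[of _ "p' + q'"]) (auto simp: complex_eval.eval_simps cpoly_in)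
next
  case (mult p q)
  then obtain p' q' where "p' \<in> C L" "q' \<in> C L" "dirderiv s v (ev p) = ev p'" "dirderiv s v (ev q) = ev q'"
    by blast
  with dirderiv_mult[OF ev_polyfun[OF C_subset] ev_polyfun[OF C_subset], OF mult.hyps, of v] mult.hyps
  show ?case
    by (intro bexI[of _ "p' * q + p * q'"]) (auto simp: complex_eval.eval_simps cpoly_in)
qed

lemma var_decompose:
  assumes "l \<in> E_dual s" "m \<in> E_dual s"
  shows "cpoly_var l - (cpoly_const c * cpoly_var m + cpoly_var (l - fun_scale c m)) \<in> Z"
proof -
  let ?d = "l - fun_scale c m"
  have d: "?d \<in> E_dual s" using assms by (auto simp: dual_space_def fun_scale_def algebra_simps)
  have "cpoly_var (fun_scale c m + ?d) - (cpoly_var (fun_scale c m) + cpoly_var ?d) \<in> Z"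
    by (rule var_add_congr[OF dual_space_scale[OF assms(2)] d])
  from sym_ideal_simps(3)[OF this var_scale_congr[OF assms(2), of c]]
  show ?thesis by (simp add: algebra_simps)
qed

lemma poly_in_carrier:
  "\<forall>k. coeff R k \<in> carrier (cpoly_ring W) \<Longrightarrow> x \<in> carrier (cpoly_ring W) \<Longrightarrow> poly R x \<in> carrier (cpoly_ring W)"
  unfolding poly_altdef by (auto intro!: cpoly_in)

text \<open>A functional \<open>m\<close> with \<open>m v = 1\<close> splits the dual of
  \<open>E / L\<close> into the line of \<open>m\<close> and the functionals that also kill
  \<open>v\<close>. So, modulo the linear relations, \<open>q\<close> is a univariate polynomial in
  \<open>m\<close> with coefficients on the contraction by \<open>v\<close>.\<close>

lemma decompose:
  assumes q: "q \<in> C L" and m: "m \<in> annihilator s L" "m v = 1"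
  shows "\<exists>R. (\<forall>k. coeff R k \<in> C (insert v L)) \<and> q - poly R (cpoly_var m) \<in> Z"
  using q
proof (induction q rule: cpoly_induct)
  case (const c)
  show ?case
    by (rule exI[of _ "[:cpoly_const c:]"]) (auto simp: coeff_pCons sym_ideal_simps cpoly_in split: nat.splits)
next
  case (var l)
  have l: "l \<in> E_dual s" and me: "m \<in> E_dual s" using var m by (auto simp: annihilator_def)
  \<comment> \<open>Subtracting \<open>l v\<close> times \<open>m\<close> removes the value at
    \<open>v\<close>, since \<open>m v = 1\<close>.\<close>
  have "l - fun_scale (l v) m \<in> annihilator s (insert v L)"
    using var m by (auto simp: annihilator_def dual_space_def fun_scale_def algebra_simps)
  then show ?case
    using var_decompose[OF l me, of "l v"]
    by (intro exI[of _ "[:cpoly_var (l - fun_scale (l v) m), cpoly_const (l v):]"])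
       (auto simp: coeff_pCons cpoly_in algebra_simps split: nat.splits)
next
  case (add p r)
  then obtain P R where P: "\<forall>k. coeff P k \<in> C (insert v L)" "p - poly P (cpoly_var m) \<in> Z"
    and R: "\<forall>k. coeff R k \<in> C (insert v L)" "r - poly R (cpoly_var m) \<in> Z" by blast
  show ?case
    using sym_ideal_simps(3)[OF P(2) R(2)] P(1) R(1)
    by (intro exI[of _ "P + R"]) (auto simp: cpoly_in algebra_simps)
next
  case (mult p r)
  then obtain P R where P: "\<forall>k. coeff P k \<in> C (insert v L)" "p - poly P (cpoly_var m) \<in> Z"
    and R: "\<forall>k. coeff R k \<in> C (insert v L)" "r - poly R (cpoly_var m) \<in> Z" by blast
  have "poly R (cpoly_var m) \<in> C L"
    using R m by (intro poly_in_carrier) (auto intro!: cpoly_in C_anti[of L "insert v L"])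
  then have "p * r - poly (P * R) (cpoly_var m) \<in> Z"
    using P R mult.hyps by (auto intro!: ideal_cpoly_mult[OF ideal_sym_dual] C_subset)
  then show ?case
    using P R by (intro exI[of _ "P * R"]) (auto simp: coeff_mult intro!: cpoly_in)
qed

end

section \<open>Deletion and contraction\<close>

text \<open>Vectors of \<open>L\<close> have been contracted: functionals on \<open>E / L\<close> are functionals on \<open>E\<close>
  vanishing on \<open>L\<close>, and hyperplanes of \<open>E / L\<close> are hyperplanes of \<open>E\<close> containing \<open>L\<close>.\<close>

inductive_set essential_ideal ::
    "(complex \<Rightarrow> 'e::ab_group_add \<Rightarrow> 'e) \<Rightarrow> 'e list \<Rightarrow> 'e set \<Rightarrow> ('e \<Rightarrow> complex) cpoly set"
    for s vs L where
  zero: "0 \<in> essential_ideal s vs L"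
| step: "G \<in> essential_ideal s vs L \<Longrightarrow> q \<in> carrier (cpoly_ring (annihilator s L)) \<Longrightarrow>
    l \<in> annihilator s L \<Longrightarrow> l \<noteq> 0 \<Longrightarrow>
    module.span s (L \<union> {u \<in> set vs. l u = 0}) = {x. l x = 0} \<Longrightarrow>
    G + q * cpoly_var l ^ Suc (length (filter (\<lambda>u. l u \<noteq> 0) vs)) \<in> essential_ideal s vs L"

lemma essential_ideal_add:
  "G \<in> essential_ideal s vs L \<Longrightarrow> F \<in> essential_ideal s vs L \<Longrightarrow> F + G \<in> essential_ideal s vs L"
  by (induction rule: essential_ideal.induct)
     (auto simp: add.assoc[symmetric] simp del: power_Suc intro: essential_ideal.step)

lemma essential_ideal_mult:
  "G \<in> essential_ideal s vs L \<Longrightarrow> q \<in> carrier (cpoly_ring (annihilator s L)) \<Longrightarrow>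
    q * G \<in> essential_ideal s vs L"
  by (induction rule: essential_ideal.induct)
     (auto simp: distrib_left mult.assoc[symmetric] simp del: power_Suc
       intro: essential_ideal.intros cpoly_mult_in)

lemma essential_ideal_sum:
  "(\<And>i. i \<in> A \<Longrightarrow> f i \<in> essential_ideal s vs L) \<Longrightarrow> sum f A \<in> essential_ideal s vs L"
  by (induction A rule: infinite_finite_induct)
     (auto intro: essential_ideal.zero essential_ideal_add)

lemma essential_ideal_in:
  "G \<in> essential_ideal s vs L \<Longrightarrow> G \<in> carrier (cpoly_ring (annihilator s L))"
  by (induction rule: essential_ideal.induct) (auto intro!: cpoly_in simp del: power_Suc)

text \<open>Termwise integration in a coordinate that grows at unit speed. The offset
  \<open>k\<close> allows for an extra power of the same coordinate: it is 0 when
  \<open>\<lambda>\<close> is constant along \<open>v\<close>, and the exponent of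
  \<open>\<lambda>\<close> otherwise.\<close>

lemma antiderivative_sum:
  fixes m :: complex
  shows "((\<lambda>t. \<Sum>i\<le>n. b i / of_nat (Suc (i + k)) * (m + t) ^ Suc (i + k)) has_field_derivative
    (\<Sum>i\<le>n. b i * m ^ (i + k))) (at 0)"
proof -
  have "((\<lambda>t. b i / of_nat (Suc (i + k)) * (m + t) ^ Suc (i + k)) has_field_derivative
      b i * m ^ (i + k)) (at 0)" for i
  proof -
    have "((\<lambda>t. (m + t) ^ Suc (i + k)) has_field_derivative
        (1 + of_nat (i + k)) * (1 * (m + 0) ^ (i + k))) (at 0)"
      by (rule DERIV_power_Suc) (auto intro!: derivative_eq_intros)
    moreover have "of_nat (Suc (i + k)) \<noteq> (0 :: complex)" by (rule of_nat_neq_0)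
    then have "b i / of_nat (Suc (i + k)) * ((1 + of_nat (i + k)) * (1 * (m + 0) ^ (i + k))) = b i * m ^ (i + k)"
      by (simp only: of_nat_Suc) simp
    ultimately show ?thesis using DERIV_cmult by metis
  qed
  then show ?thesis by (intro DERIV_sum)
qed

context complex_space begin

text \<open>The exponent in a generator exceeds by one the number of listed vectors off its
  hyperplane, which is exactly the bound of \<open>vanishing_functional_power\<close>.\<close>

lemma essential_ideal_vanishing:
  "G \<in> essential_ideal s vs L \<Longrightarrow> squarefree_vanishing s vs (ev G)"
proof (induction rule: essential_ideal.induct)
  case zero
  then show ?case by (simp add: complex_eval.eval_simps vanishing_zero)
next
  case (step G q l)
  have l: "l \<in> E_dual s" using step by (simp add: annihilator_def)
  note q = ev_polyfun[OF C_subset[OF step(2)]] and G = ev_polyfun[OF C_subset[OF essential_ideal_in[OF step(1)]]]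
  note lp = polyfun_power[OF polyfun.functional[OF l]]
  show ?case
    using vanishing_add[OF G polyfun.mult[OF lp q] step.IH
        vanishing_mult[OF lp q vanishing_functional_power[OF l order_refl]]]
    by (simp add: complex_eval.eval_simps mult.commute del: power_Suc)
qed

text \<open>A functional that kills \<open>v\<close> has equally many vectors off its kernel whether
  \<open>v\<close> is listed or contracted, and in both cases \<open>v\<close> belongs to the
  vectors spanning that kernel.\<close>

lemma contraction_subset:
  assumes "G \<in> essential_ideal s vs (insert v L)"
  shows "G \<in> essential_ideal s (v # vs) L"
  using assms
proof (induction rule: essential_ideal.induct)
  case (step G q l)
  have l: "l \<in> annihilator s L" "l v = 0" using step by (auto simp: annihilator_def)
  have "L \<union> {u \<in> set (v # vs). l u = 0} = insert v L \<union> {u \<in> set vs. l u = 0}"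
    using l(2) by auto
  then have "span (L \<union> {u \<in> set (v # vs). l u = 0}) = {x. l x = 0}"
    using step.hyps(5) by simp
  with essential_ideal.step[OF step.IH C_anti[OF subset_insertI step(2)] l(1) step(4)]
  show ?case using l(2) by (simp del: power_Suc)
qed (rule essential_ideal.zero)

text \<open>Modulo \<open>span S\<close> every vector is a multiple of \<open>v\<close>, and
  \<open>l\<close> detects that multiple.\<close>

lemma kernel_eq_span:
  assumes "span (insert v S) = UNIV" "l \<in> E_dual s" "\<And>x. x \<in> S \<Longrightarrow> l x = 0" "l v \<noteq> 0"
  shows "{x. l x = 0} = span S"
proof
  show "span S \<subseteq> {x. l x = 0}" using functional_span[OF assms(2,3)] by blast
  show "{x. l x = 0} \<subseteq> span S"
  proof
    fix x assume "x \<in> {x. l x = 0}"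
    moreover obtain k where k: "x - s k v \<in> span S"
      using assms(1) span_breakdown_eq[of x v S] by auto
    moreover have "l (x - s k v) = l x - k * l v"
      using functional_simps(1)[OF assms(2), of "x - s k v" "s k v"]
      by (simp add: functional_simps(2)[OF assms(2)])
    ultimately have "k = 0" using functional_span[OF assms(2,3) k] assms(4) by simp
    with k show "x \<in> span S" by simp
  qed
qed

text \<open>Surjectivity of the derivative along \<open>v\<close> from the ideal with
  \<open>v\<close> onto the ideal with \<open>v\<close> deleted. Each multiple of a generator is
  integrated separately: if \<open>l v = 0\<close> the power of \<open>l\<close> is constant along
  \<open>v\<close>, and if not, integration raises its exponent by one, just as the extra vector
  \<open>v\<close> demands.\<close>

lemma antiderivative:
  assumes "G \<in> essential_ideal s vs L" and v: "v \<notin> span L"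
  shows "\<exists>F\<in>essential_ideal s (v # vs) L. dirderiv s v (ev F) = ev G"
  using assms(1)
proof (induction rule: essential_ideal.induct)
  case zero
  show ?case
    by (rule bexI[OF _ essential_ideal.zero]) (simp add: complex_eval.eval_simps dirderiv_const)
next
  case (step G q l)
  let ?d = "length (filter (\<lambda>u. l u \<noteq> 0) vs)"
  have l: "l \<in> E_dual s" using step by (simp add: annihilator_def)
  have "\<exists>F\<in>essential_ideal s (v # vs) L. dirderiv s v (ev F) = ev (q * cpoly_var l ^ Suc ?d)"
  proof (cases "l v = 0")
    case True
    obtain m where m: "m \<in> annihilator s L" "m v = 1"
      using ex_functional[OF v] by (auto simp: annihilator_def)
    have me: "m \<in> E_dual s" using m by (simp add: annihilator_def)
    obtain R where R: "\<forall>k. coeff R k \<in> C (insert v L)" "q - poly R (cpoly_var m) \<in> Z"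
      using decompose[OF step(2) m] by blast
    \<comment> \<open>Integration along \<open>v\<close> turns \<open>m ^ i\<close> into
      \<open>m ^ (i+1) / (i+1)\<close>; the coefficients of \<open>R\<close> do not vary along
      \<open>v\<close>.\<close>
    define Q where "Q = (\<Sum>i\<le>degree R. cpoly_const (1 / of_nat (Suc i)) * coeff R i * cpoly_var m ^ Suc i)"
    have Q: "Q \<in> C L"
      unfolding Q_def using C_anti[OF subset_insertI R(1)[rule_format]] m by (auto intro!: cpoly_in simp del: power_Suc)
    \<comment> \<open>Here \<open>v\<close> already lies in the hyperplane, so listing it does not
      enlarge the span.\<close>
    have ker: "span (L \<union> {u \<in> set (v # vs). l u = 0}) = {x. l x = 0}"
    proof -
      have "v \<in> span (L \<union> {u \<in> set vs. l u = 0})" using True step.hyps(5) by simp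
      moreover have "L \<union> {u \<in> set (v # vs). l u = 0} = insert v (L \<union> {u \<in> set vs. l u = 0})"
        using True by auto
      ultimately show ?thesis using step.hyps(5) by (simp add: span_redundant)
    qed
    have "dirderiv s v (ev (Q * cpoly_var l ^ Suc ?d)) x = ev (q * cpoly_var l ^ Suc ?d) x" for x
    proof (rule dirderiv_eqI)
      let ?b = "\<lambda>i. ev (coeff R i) x * l x ^ Suc ?d"
      have 1: "ev (Q * cpoly_var l ^ Suc ?d) (x + s t v) =
          (\<Sum>i\<le>degree R. ?b i / of_nat (Suc (i + 0)) * (m x + t) ^ Suc (i + 0))" for t
        using R ev_translate[of _ "insert v L" v x t] True m(2)
        by (simp add: Q_def complex_eval.eval_simps functional_simps[OF l] functional_simps[OF me]
            sum_distrib_left mult_ac del: power_Suc of_nat_Suc)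
      have 2: "ev (q * cpoly_var l ^ Suc ?d) x = (\<Sum>i\<le>degree R. ?b i * m x ^ (i + 0))"
        using ev_congr[OF R(2), of x]
        by (simp add: complex_eval.eval_simps poly_altdef sum_distrib_left mult_ac del: power_Suc)
      show "((\<lambda>t. ev (Q * cpoly_var l ^ Suc ?d) (x + s t v)) has_field_derivative
          ev (q * cpoly_var l ^ Suc ?d) x) (at 0)"
        unfolding 1 2 by (rule antiderivative_sum)
    qed
    moreover have "Q * cpoly_var l ^ Suc ?d \<in> essential_ideal s (v # vs) L"
      using essential_ideal.step[OF essential_ideal.zero Q step(3,4) ker] True by (simp del: power_Suc)
    ultimately show ?thesis by blast
  next
    case False
    define c where "c = l v"
    have c: "c \<noteq> 0" using False by (simp add: c_def)
    \<comment> \<open>The functional \<open>l\<close> itself, rescaled to take the value 1 at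
      \<open>v\<close>, serves as the coordinate along \<open>v\<close>.\<close>
    define m where "m = fun_scale (1 / c) l"
    have me: "m \<in> E_dual s" unfolding m_def by (rule dual_space_scale[OF l])
    have m: "m \<in> annihilator s L" "m v = 1" and lm: "l x = c * m x" for x
      using step(3) c me by (auto simp: annihilator_def m_def fun_scale_def c_def)
    obtain R where R: "\<forall>k. coeff R k \<in> C (insert v L)" "q - poly R (cpoly_var m) \<in> Z"
      using decompose[OF step(2) m] by blast
    \<comment> \<open>With \<open>l = c m\<close> and \<open>d\<close> the length of the filtered
      list, the term \<open>m^i l^(d+1)\<close> equals \<open>c^(d+1) m^(i+d+1)\<close>. Its
      integral is \<open>m^i l^(d+2) / (c (i+d+2))\<close>, which explains the coefficient and
      leaves the factor \<open>l^(d+2)\<close> outside.\<close>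
    define Q where "Q = (\<Sum>i\<le>degree R. cpoly_const (1 / c / of_nat (Suc (i + Suc ?d))) * coeff R i * cpoly_var m ^ i)"
    have Q: "Q \<in> C L"
      unfolding Q_def using C_anti[OF subset_insertI R(1)[rule_format]] m by (auto intro!: cpoly_in)
    have ker: "span (L \<union> {u \<in> set (v # vs). l u = 0}) = {x. l x = 0}"
    proof -
      have "{u \<in> set (v # vs). l u = 0} = {u \<in> set vs. l u = 0}" using False by auto
      then show ?thesis using step.hyps(5) by simp
    qed
    have "dirderiv s v (ev (Q * cpoly_var l ^ Suc (Suc ?d))) x = ev (q * cpoly_var l ^ Suc ?d) x" for x
    proof (rule dirderiv_eqI)
      let ?b = "\<lambda>i. ev (coeff R i) x * c ^ Suc ?d"
      have 1: "ev (Q * cpoly_var l ^ Suc (Suc ?d)) (x + s t v) =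
          (\<Sum>i\<le>degree R. ?b i / of_nat (Suc (i + Suc ?d)) * (m x + t) ^ Suc (i + Suc ?d))" for t
      proof -
        have "ev (Q * cpoly_var l ^ Suc (Suc ?d)) (x + s t v) =
          (\<Sum>i\<le>degree R. 1 / c / of_nat (Suc (i + Suc ?d)) * ev (coeff R i) x * (m x + t) ^ i) *
          (c * (m x + t)) ^ Suc (Suc ?d)"
          using R ev_translate[of _ "insert v L" v x t] m(2)
          by (simp add: Q_def complex_eval.eval_simps lm functional_simps[OF me] del: power_Suc of_nat_Suc)
        also have "\<dots> = (\<Sum>i\<le>degree R. ?b i / of_nat (Suc (i + Suc ?d)) * (m x + t) ^ Suc (i + Suc ?d))"
          unfolding sum_distrib_right
          by (intro sum.cong refl) (use c in \<open>simp add: power_mult_distrib power_add mult_ac del: of_nat_Suc\<close>)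
        finally show ?thesis .
      qed
      have 2: "ev (q * cpoly_var l ^ Suc ?d) x = (\<Sum>i\<le>degree R. ?b i * m x ^ (i + Suc ?d))"
        using ev_congr[OF R(2), of x]
        by (simp add: complex_eval.eval_simps poly_altdef sum_distrib_left sum_distrib_right lm power_mult_distrib
            power_add mult_ac)
      show "((\<lambda>t. ev (Q * cpoly_var l ^ Suc (Suc ?d)) (x + s t v)) has_field_derivative
          ev (q * cpoly_var l ^ Suc ?d) x) (at 0)"
        unfolding 1 2 by (rule antiderivative_sum)
    qed
    moreover have "Q * cpoly_var l ^ Suc (Suc ?d) \<in> essential_ideal s (v # vs) L"
      using essential_ideal.step[OF essential_ideal.zero Q step(3,4) ker] False by (simp del: power_Suc)
    ultimately show ?thesis by blast
  qed
  then obtain F where F: "F \<in> essential_ideal s (v # vs) L" "dirderiv s v (ev F) = ev (q * cpoly_var l ^ Suc ?d)"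
    by blast
  obtain F' where F': "F' \<in> essential_ideal s (v # vs) L" "dirderiv s v (ev F') = ev G"
    using step.IH by blast
  show ?case
    using dirderiv_add[OF ev_polyfun[OF C_subset] ev_polyfun[OF C_subset],
        OF essential_ideal_in[OF F'(1)] essential_ideal_in[OF F(1)], of v] F F'
    by (intro bexI[of _ "F' + F"])
       (auto simp: complex_eval.eval_add intro: essential_ideal_add simp del: power_Suc)
qed

text \<open>Every functional vanishing on \<open>L\<close> also kills such a \<open>v\<close>, so
  \<open>v\<close> affects neither the exponents nor the spans.\<close>

lemma loop_subset:
  assumes "G \<in> essential_ideal s vs L" "v \<in> span L"
  shows "G \<in> essential_ideal s (v # vs) L"
  using assms(1)
proof (induction rule: essential_ideal.induct)
  case (step G q l)
  have l: "l v = 0"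
    using step(3) functional_span[OF _ _ assms(2), of l] by (auto simp: annihilator_def)
  have eq: "L \<union> {u \<in> set (v # vs). l u = 0} = insert v (L \<union> {u \<in> set vs. l u = 0})"
    using l by auto
  have "v \<in> span (L \<union> {u \<in> set vs. l u = 0})"
    using assms(2) span_mono[of L "L \<union> {u \<in> set vs. l u = 0}"] by auto
  then have "span (L \<union> {u \<in> set (v # vs). l u = 0}) = {x. l x = 0}"
    unfolding eq using step.hyps(5) by (simp add: span_redundant)
  with essential_ideal.step[OF step.IH step(2,3,4)] l show ?case by (simp del: power_Suc)
qed (rule essential_ideal.zero)

lemma ev_dirderiv_zero: "q \<in> C L \<Longrightarrow> v \<in> L \<Longrightarrow> dirderiv s v (ev q) = (\<lambda>x. 0)"
  by (intro ext dirderiv_eqI) (simp add: ev_translate)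

lemma ev_poly:
  "ev (poly R (cpoly_var m)) x = (\<Sum>i\<le>degree R. ev (coeff R i) x * m x ^ i)"
  by (simp add: poly_altdef complex_eval.eval_simps)

lemma essential_ideal_poly:
  assumes "\<And>k. \<exists>G\<in>essential_ideal s vs L. coeff R k - G \<in> Z" "m \<in> annihilator s L"
  shows "\<exists>G\<in>essential_ideal s vs L. poly R (cpoly_var m) - G \<in> Z"
proof -
  obtain G where G: "\<And>k. G k \<in> essential_ideal s vs L" "\<And>k. coeff R k - G k \<in> Z"
    using assms(1) by metis
  have m: "cpoly_var m ^ k \<in> C L" for k using assms(2) by (auto intro!: cpoly_in)
  have "(\<Sum>k\<le>degree R. cpoly_var m ^ k * G k) \<in> essential_ideal s vs L"
    by (intro essential_ideal_sum essential_ideal_mult G m)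
  moreover have "(\<Sum>k\<le>n. cpoly_var m ^ k * (coeff R k - G k)) \<in> Z" for n
    by (induction n) (auto intro!: sym_ideal_simps C_subset[OF m] G(2) simp del: power_Suc)
  then have "poly R (cpoly_var m) - (\<Sum>k\<le>degree R. cpoly_var m ^ k * G k) \<in> Z"
    by (simp add: poly_altdef sum_subtractf algebra_simps)
  ultimately show ?thesis by blast
qed

text \<open>On the line through \<open>x\<close> in direction \<open>v\<close> the function is an
  ordinary polynomial in the value of \<open>m\<close>, with constant coefficients. Its derivative
  vanishes identically, hence so do all coefficients beyond the constant one.\<close>

lemma coeff_ev_zero:
  assumes R: "\<forall>k. coeff R k \<in> C (insert v L)" and m: "m \<in> E_dual s" "m v = 1"
    and D: "dirderiv s v (ev (poly R (cpoly_var m))) = (\<lambda>x. 0)" and k: "k > 0"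
  shows "ev (coeff R k) x = 0"
proof (cases "k \<le> degree R")
  case True
  let ?a = "\<lambda>i. ev (coeff R i) x"
  have "(\<Sum>i\<le>degree R. (of_nat i * ?a i) * t ^ i) = 0" for t
  proof -
    \<comment> \<open>The point of that line at which \<open>m\<close> takes the value
      \<open>t\<close>.\<close>
    define y where "y = x + s (t - m x) v"
    have my: "m y = t" by (simp add: y_def functional_simps[OF m(1)] m(2))
    have a: "ev (coeff R i) (y + s u v) = ?a i" for i u
      using R by (simp add: y_def ev_translate[of _ "insert v L"])
    have "dirderiv s v (ev (poly R (cpoly_var m))) y = (\<Sum>i\<le>degree R. ?a i * (of_nat i * t ^ (i - 1)))"
    proof (rule dirderiv_eqI)
      show "((\<lambda>u. ev (poly R (cpoly_var m)) (y + s u v)) has_field_derivative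
          (\<Sum>i\<le>degree R. ?a i * (of_nat i * t ^ (i - 1)))) (at 0)"
        unfolding ev_poly a functional_simps[OF m(1)] my m(2)
        by (auto intro!: derivative_eq_intros simp: mult_ac)
    qed
    \<comment> \<open>Multiplication by \<open>t\<close> turns the truncated exponent
      \<open>i - 1\<close> into \<open>i\<close>, the term \<open>i = 0\<close> being zero anyway,
      so that a polynomial in standard form vanishes for every \<open>t\<close>.\<close>
    then have "0 = (\<Sum>i\<le>degree R. ?a i * (of_nat i * t ^ (i - 1))) * t"
      by (simp add: D)
    also have "\<dots> = (\<Sum>i\<le>degree R. (of_nat i * ?a i) * t ^ i)"
      unfolding sum_distrib_right
    proof (intro sum.cong refl)
      fix i show "?a i * (of_nat i * t ^ (i - 1)) * t = (of_nat i * ?a i) * t ^ i"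
        by (cases i) (auto simp: mult_ac)
    qed
    finally show ?thesis by simp
  qed
  then have "of_nat k * ?a k = 0"
    using polyfun_eq_0[of "\<lambda>i. of_nat i * ?a i" "degree R"] True by blast
  then show ?thesis using k by simp
next
  case False
  then show ?thesis by (simp add: coeff_eq_0 complex_eval.eval_simps)
qed

text \<open>The induction leaves \<open>L\<close> and \<open>q\<close> free: deletion keeps
  \<open>L\<close> and changes \<open>q\<close>, while contraction moves the head of the list into
  \<open>L\<close>. The head is a loop, a vector whose deletion leaves a spanning family, or one
  whose deletion leaves only a hyperplane.\<close>

theorem essential_ideal_complete:
  assumes "span (L \<union> set vs) = UNIV" "q \<in> C L" "squarefree_vanishing s vs (ev q)"
  shows "\<exists>G\<in>essential_ideal s vs L. q - G \<in> Z"
  using assms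
proof (induction vs arbitrary: L q)
  case Nil
  \<comment> \<open>Now \<open>L\<close> alone spans, so only the zero functional is left and every
    polynomial is congruent to a constant, namely its value at 0.\<close>
  have van: "l = 0" if "l \<in> annihilator s L" for l
  proof
    fix x show "l x = 0 x"
      using functional_span[of l L x] that Nil.prems(1) by (auto simp: annihilator_def)
  qed
  have "\<exists>c. q - cpoly_const c \<in> Z" using Nil.prems(2)
  proof (induction q rule: cpoly_induct)
    case (const c)
    show ?case by (rule exI[of _ c]) (simp add: sym_ideal_simps)
  next
    case (var l)
    show ?case using van[OF var] by (intro exI[of _ 0]) (simp add: var_zero_congr)
  next
    case (add p r)
    then obtain c d where "p - cpoly_const c \<in> Z" "r - cpoly_const d \<in> Z" by blast
    from sym_ideal_simps(3)[OF this] show ?case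
      by (intro exI[of _ "c + d"]) (simp add: cpoly_const_add algebra_simps)
  next
    case (mult p r)
    then obtain c d where "p - cpoly_const c \<in> Z" "r - cpoly_const d \<in> Z" by blast
    from ideal_cpoly_mult[OF ideal_sym_dual this C_subset[OF mult.hyps(1)] cpoly_const_in] show ?case
      by (intro exI[of _ "c * d"]) (simp add: cpoly_const_mult)
  qed
  then obtain c where c: "q - cpoly_const c \<in> Z" by blast
  have "c = 0" using ev_congr[OF c, of 0] Nil.prems(3) by (simp add: complex_eval.eval_simps)
  then show ?case using c by (intro bexI[OF _ essential_ideal.zero]) simp
next
  case (Cons v vs)
  note q = Cons.prems(2)
  have q_pf: "ev q \<in> polyfun s" by (rule ev_polyfun[OF C_subset[OF q]])
  have K: "squarefree_vanishing s vs (ev q)" "squarefree_vanishing s vs (dirderiv s v (ev q))"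
    using Cons.prems(3) by auto
  have span_v: "span (insert v (L \<union> set vs)) = UNIV" using Cons.prems(1) by simp
  show ?case
  proof (cases "v \<in> span L")
    case True
    then have "v \<in> span (L \<union> set vs)" using span_mono[of L "L \<union> set vs"] by auto
    then have "span (L \<union> set vs) = UNIV" using span_v by (simp add: span_redundant)
    from Cons.IH[OF this q K(1)] show ?thesis using loop_subset[OF _ True] by blast
  next
    case vL: False
    \<comment> \<open>The induction hypothesis for \<open>insert v L\<close>, carried back to the
      list containing \<open>v\<close>.\<close>
    have contraction: "\<exists>G\<in>essential_ideal s (v # vs) L. p - G \<in> Z"
      if "p \<in> C (insert v L)" "squarefree_vanishing s vs (ev p)" for p
      using Cons.IH[of "insert v L" p] that span_v contraction_subset by auto
    show ?thesis
    proof (cases "v \<in> span (L \<union> set vs)")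
      case True
      then have sp: "span (L \<union> set vs) = UNIV" using span_v by (simp add: span_redundant)
      \<comment> \<open>The derivative of \<open>q\<close> along \<open>v\<close> is in the kernel
        for the remaining list; integrating its ideal representative gives an \<open>F\<close> with
        the same derivative as \<open>q\<close>.\<close>
      obtain q1 where q1: "q1 \<in> C L" "dirderiv s v (ev q) = ev q1" using ev_dirderiv[OF q] by blast
      obtain G1 where G1: "G1 \<in> essential_ideal s vs L" "q1 - G1 \<in> Z"
        using Cons.IH[OF sp q1(1)] K(2) q1(2) by auto
      obtain F where F: "F \<in> essential_ideal s (v # vs) L" "dirderiv s v (ev F) = ev G1"
        using antiderivative[OF G1(1) vL] by blast
      have F_pf: "ev F \<in> polyfun s" by (rule ev_polyfun[OF C_subset[OF essential_ideal_in[OF F(1)]]])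
      obtain m where m: "m \<in> annihilator s L" "m v = 1"
        using ex_functional[OF vL] by (auto simp: annihilator_def)
      have me: "m \<in> E_dual s" using m by (simp add: annihilator_def)
      have qF: "q - F \<in> C L" using q essential_ideal_in[OF F(1)] by (rule cpoly_diff_in)
      \<comment> \<open>The difference \<open>q - F\<close> has zero derivative along
        \<open>v\<close>, so as a function only the constant coefficient of \<open>R\<close> in
        \<open>m\<close> remains.\<close>
      obtain R where R: "\<forall>k. coeff R k \<in> C (insert v L)" "q - F - poly R (cpoly_var m) \<in> Z"
        using decompose[OF qF m] by blast
      have ev_R: "ev (poly R (cpoly_var m)) = (\<lambda>x. ev q x - ev F x)"
        using ev_congr[OF R(2)] by (auto simp: complex_eval.eval_simps)
      have KR: "squarefree_vanishing s (v # vs) (ev (poly R (cpoly_var m)))"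
        unfolding ev_R
        by (rule vanishing_diff[OF q_pf F_pf Cons.prems(3) essential_ideal_vanishing[OF F(1)]])
      have "dirderiv s v (ev (poly R (cpoly_var m))) = (\<lambda>x. 0)"
      proof -
        have "dirderiv s v (\<lambda>x. ev F x + ev (poly R (cpoly_var m)) x) =
            (\<lambda>x. dirderiv s v (ev F) x + dirderiv s v (ev (poly R (cpoly_var m))) x)"
          by (rule dirderiv_add[OF F_pf]) (simp add: ev_R polyfun_diff q_pf F_pf)
        moreover have "(\<lambda>x. ev F x + ev (poly R (cpoly_var m)) x) = ev q" by (simp add: fun_cong[OF ev_R])
        moreover have "dirderiv s v (ev F) = dirderiv s v (ev q)"
          using F(2) q1(2) ev_congr[OF G1(2)] by simp
        ultimately show ?thesis by (simp add: fun_eq_iff)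
      qed
      note zero = coeff_ev_zero[OF R(1) me m(2) this]
      \<comment> \<open>Higher coefficients are zero functions, and the constant one is the function
        \<open>q - F\<close> itself; thus the contraction hypothesis covers every
        coefficient.\<close>
      have "squarefree_vanishing s vs (ev (coeff R k))" for k
      proof (cases "k = 0")
        case False
        then show ?thesis using zero[of k] by (simp add: vanishing_zero)
      next
        case True
        have "ev (poly R (cpoly_var m)) x = ev (coeff R 0) x" for x
          unfolding ev_poly by (subst sum.atMost_shift) (simp add: zero)
        then show ?thesis using KR True by simp
      qed
      with contraction R(1) have "\<And>k. \<exists>G\<in>essential_ideal s (v # vs) L. coeff R k - G \<in> Z"
        by blast
      from essential_ideal_poly[OF this m(1)] obtain G where
        G: "G \<in> essential_ideal s (v # vs) L" "poly R (cpoly_var m) - G \<in> Z" by blast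
      have "q - (F + G) \<in> Z"
        using sym_ideal_simps(3)[OF R(2) G(2)] by (simp add: algebra_simps)
      then show ?thesis using essential_ideal_add[OF G(1) F(1)] by blast
    next
      case False
      \<comment> \<open>The remaining vectors and \<open>L\<close> span a hyperplane missing
        \<open>v\<close>. Its functional \<open>l\<close> is nonzero on no listed vector but
        \<open>v\<close>, so its generator has exponent 2.\<close>
      obtain l where le: "l \<in> E_dual s" and lv: "l v = 1" and l0: "\<And>x. x \<in> L \<union> set vs \<Longrightarrow> l x = 0"
        using ex_functional[OF False] by blast
      have l: "l \<in> annihilator s L" using le l0 by (auto simp: annihilator_def)
      have ker: "span (L \<union> {u \<in> set (v # vs). l u = 0}) = {x. l x = 0}"
      proof -
        have "L \<union> {u \<in> set (v # vs). l u = 0} = L \<union> set vs" using lv l0 by auto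
        then show ?thesis using kernel_eq_span[OF span_v le l0] lv by simp
      qed
      have l_nz: "l \<noteq> 0" using lv by auto
      have filt: "filter (\<lambda>u. l u \<noteq> 0) vs = []" using l0 by (auto simp: filter_empty_conv)
      obtain R where R: "\<forall>k. coeff R k \<in> C (insert v L)" "q - poly R (cpoly_var l) \<in> Z"
        using decompose[OF q l lv] by blast
      \<comment> \<open>Modulo the square of \<open>l\<close> only the two lowest coefficients
        matter.\<close>
      obtain a0 a1 R2 where R2: "R = pCons a0 (pCons a1 R2)" by (metis pCons_cases)
      have a: "a0 \<in> C (insert v L)" "a1 \<in> C (insert v L)" "\<forall>k. coeff R2 k \<in> C (insert v L)"
        using R(1)[rule_format, of 0] R(1)[rule_format, of 1] R(1)[rule_format, of "Suc (Suc k)" for k]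
        by (auto simp: R2)
      define Q where "Q = poly R2 (cpoly_var l)"
      have Q: "Q \<in> C L" unfolding Q_def
        using a(3) l C_anti[OF subset_insertI] by (intro poly_in_carrier) (auto intro: cpoly_in)
      have aL: "a0 \<in> C L" "a1 \<in> C L" using a C_anti[OF subset_insertI] by blast+
      note pf = ev_polyfun[OF C_subset[OF aL(1)]] ev_polyfun[OF C_subset[OF aL(2)]]
        ev_polyfun[OF C_subset[OF Q]] polyfun.functional[OF le] dirderiv_polyfun polyfun.const
      have ev_q: "ev q = (\<lambda>x. ev a0 x + l x * (ev a1 x + l x * ev Q x))"
        using ev_congr[OF R(2)] by (auto simp: R2 complex_eval.eval_simps Q_def)
      \<comment> \<open>Modulo multiples of \<open>l\<close>, the function of \<open>q\<close> is
        that of \<open>a0\<close> and its derivative is that of \<open>a1\<close>, because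
        \<open>l v = 1\<close> and both coefficients are constant along \<open>v\<close>.\<close>
      have Dq: "dirderiv s v (ev q) = (\<lambda>x. ev a1 x + l x * (2 * ev Q x + l x * dirderiv s v (ev Q) x))"
        unfolding ev_q
        by (simp add: dirderiv_add dirderiv_mult pf polyfun.add polyfun.mult dirderiv_functional[OF le]
            ev_dirderiv_zero[OF a(1)] ev_dirderiv_zero[OF a(2)] lv algebra_simps)
      \<comment> \<open>No vector of \<open>vs\<close> is off the kernel of \<open>l\<close>, so
        already the first power of \<open>l\<close> lies in the kernel for
        \<open>vs\<close>.\<close>
      have Kl: "squarefree_vanishing s vs (\<lambda>x. l x * g x)" if "g \<in> polyfun s" for g
        using vanishing_mult[OF polyfun.functional[OF le] that] vanishing_functional_power[OF le, of vs 0] filt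
        by simp
      have "squarefree_vanishing s vs (ev a0)"
      proof -
        have 1: "(\<lambda>x. ev a1 x + l x * ev Q x) \<in> polyfun s" by (intro pf polyfun.add polyfun.mult)
        show ?thesis
          using vanishing_diff[OF q_pf polyfun.mult[OF pf(4) 1] K(1) Kl[OF 1]] by (simp add: fun_cong[OF ev_q])
      qed
      moreover have "squarefree_vanishing s vs (ev a1)"
      proof -
        have 1: "(\<lambda>x. 2 * ev Q x + l x * dirderiv s v (ev Q) x) \<in> polyfun s"
          by (intro pf polyfun.add polyfun.mult)
        show ?thesis
          using vanishing_diff[OF dirderiv_polyfun[OF q_pf] polyfun.mult[OF pf(4) 1] K(2) Kl[OF 1]]
          by (simp add: Dq)
      qed
      ultimately obtain G0 G1 where G: "G0 \<in> essential_ideal s (v # vs) L" "a0 - G0 \<in> Z"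
        "G1 \<in> essential_ideal s (v # vs) L" "a1 - G1 \<in> Z"
        using contraction a by meson
      have "0 + Q * cpoly_var l ^ Suc (length (filter (\<lambda>u. l u \<noteq> 0) (v # vs))) \<in> essential_ideal s (v # vs) L"
        by (rule essential_ideal.step[OF essential_ideal.zero Q l l_nz ker])
      then have Q2: "Q * cpoly_var l ^ 2 \<in> essential_ideal s (v # vs) L"
        using lv filt by (simp add: power2_eq_square)
      have "q - (G0 + (cpoly_var l * G1 + Q * cpoly_var l ^ 2)) =
          (q - poly R (cpoly_var l)) + ((a0 - G0) + cpoly_var l * (a1 - G1))"
        by (simp add: R2 Q_def algebra_simps power2_eq_square)
      also have "\<dots> \<in> Z"
        using R(2) G le by (auto intro!: sym_ideal_simps cpoly_in)
      finally have "q - (G0 + (cpoly_var l * G1 + Q * cpoly_var l ^ 2)) \<in> Z" .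
      moreover have "G0 + (cpoly_var l * G1 + Q * cpoly_var l ^ 2) \<in> essential_ideal s (v # vs) L"
        using l by (intro essential_ideal_add essential_ideal_mult G Q2) (auto intro: cpoly_in)
      ultimately show ?thesis by blast
    qed
  qed
qed

end

section \<open>Quotients of quotients\<close>

lemma carrier_quot: "carrier (R Quot I) = (+>\<^bsub>R\<^esub>) I ` carrier R"
  by (auto simp: FactRing_def A_RCOSETS_def')

text \<open>An ideal containing \<open>I\<close> is a union of cosets of \<open>I\<close>.\<close>

lemma (in ideal) rcos_in_image_iff:
  assumes "ideal J R" "I \<subseteq> J" "r \<in> carrier R"
  shows "I +> r \<in> (+>) I ` J \<longleftrightarrow> r \<in> J"
proof
  interpret J: ideal J R by fact
  assume "I +> r \<in> (+>) I ` J"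
  then obtain j where j: "j \<in> J" "I +> r = I +> j" by blast
  then have "r \<in> I +> j" using a_rcos_self[OF assms(3)] by simp
  then obtain i where "i \<in> I" "r = i \<oplus> j" by (auto simp: a_r_coset_def')
  then show "r \<in> J" using assms(2) j(1) by (auto intro: J.a_closed)
qed blast

text \<open>The preimage in \<open>R\<close> of an ideal generated in \<open>R Quot I\<close>. The
  lemmas below characterise it as the smallest ideal containing both \<open>I\<close> and
  \<open>A\<close>, so ideals of Sym can be handled by polynomials instead of cosets.\<close>

definition quot_genideal :: "('a, 'b) ring_scheme \<Rightarrow> 'a set \<Rightarrow> 'a set \<Rightarrow> 'a set" where
  "quot_genideal R I A = {r \<in> carrier R. I +>\<^bsub>R\<^esub> r \<in> Idl\<^bsub>R Quot I\<^esub> ((+>\<^bsub>R\<^esub>) I ` A)}"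

context ideal begin

lemma quot_generators_in: "A \<subseteq> carrier R \<Longrightarrow> (+>) I ` A \<subseteq> carrier (R Quot I)"
  by (auto simp: FactRing_def A_RCOSETS_def')

lemma quot_genideal_ideal: "A \<subseteq> carrier R \<Longrightarrow> ideal (quot_genideal R I A) R"
  unfolding quot_genideal_def
  by (intro ring_hom_ring.ideal_vimage[OF rcos_ring_hom_ring] ring.genideal_ideal
      quotient_is_ring quot_generators_in)

lemma quot_genideal_generators: "A \<subseteq> carrier R \<Longrightarrow> A \<subseteq> quot_genideal R I A"
  using ring.genideal_self[OF quotient_is_ring quot_generators_in, of A]
  by (auto simp: quot_genideal_def)

lemma quot_genideal_base:
  assumes "A \<subseteq> carrier R"
  shows "I \<subseteq> quot_genideal R I A"
proof
  fix i assume i: "i \<in> I"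
  interpret Q: ideal "Idl\<^bsub>R Quot I\<^esub> ((+>) I ` A)" "R Quot I"
    by (intro ring.genideal_ideal quotient_is_ring quot_generators_in assms)
  have "I +> i = \<zero>\<^bsub>R Quot I\<^esub>" using a_rcos_const[OF i] by (simp add: FactRing_def)
  then show "i \<in> quot_genideal R I A"
    using additive_subgroup.zero_closed[OF Q.additive_subgroup_axioms] i a_subset
    by (auto simp: quot_genideal_def)
qed

lemma quot_genideal_minimal:
  assumes "ideal J R" "I \<subseteq> J" "A \<subseteq> J"
  shows "quot_genideal R I A \<subseteq> J"
proof -
  have "Idl\<^bsub>R Quot I\<^esub> ((+>) I ` A) \<subseteq> (+>) I ` J"
    using assms
    by (intro ring.genideal_minimal[OF quotient_is_ring] ring_ideal_imp_quot_ideal is_ideal) auto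
  then show ?thesis
    unfolding quot_genideal_def using rcos_in_image_iff[OF assms(1,2)] by blast
qed

end

text \<open>The projection to the double quotient and \<open>h\<close> have the same kernel, so the
  first isomorphism theorem identifies both the double quotient and the image of \<open>h\<close>
  with \<open>R\<close> modulo that kernel; \<open>\<theta>\<close> is the composite.\<close>

lemma (in ring_hom_ring) iterated_quotient_iso:
  assumes "ideal I R" "ideal J (R Quot I)"
    and ker: "\<And>r. r \<in> carrier R \<Longrightarrow> I +>\<^bsub>R\<^esub> r \<in> J \<longleftrightarrow> h r = \<zero>\<^bsub>S\<^esub>"
  shows "\<exists>\<theta>\<in>ring_iso ((R Quot I) Quot J) (S\<lparr>carrier := h ` carrier R\<rparr>).
    \<forall>r\<in>carrier R. \<theta> (J +>\<^bsub>R Quot I\<^esub> (I +>\<^bsub>R\<^esub> r)) = h r"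
proof -
  interpret I: ideal I R by fact
  interpret J: ideal J "R Quot I" by fact
  let ?T = "(R Quot I) Quot J"
  define p where "p = (\<lambda>r. J +>\<^bsub>R Quot I\<^esub> (I +>\<^bsub>R\<^esub> r))"
  have "p \<in> ring_hom R ?T"
    using ring_hom_trans[OF I.rcos_ring_hom J.rcos_ring_hom] by (simp add: p_def comp_def)
  then interpret p: ring_hom_ring R ?T p
    by (intro ring_hom_ringI2 R.ring_axioms J.quotient_is_ring)
  have p0: "p r = \<zero>\<^bsub>?T\<^esub> \<longleftrightarrow> I +>\<^bsub>R\<^esub> r \<in> J" if "r \<in> carrier R" for r
  proof -
    have c: "I +>\<^bsub>R\<^esub> r \<in> carrier (R Quot I)"
      using that by (auto simp: FactRing_def A_RCOSETS_def')
    have "\<zero>\<^bsub>?T\<^esub> = J" by (simp add: FactRing_def)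
    then show ?thesis
      unfolding p_def using J.a_rcos_const[of "I +>\<^bsub>R\<^esub> r"] J.a_rcos_self[OF c] by auto
  qed
  have K: "a_kernel R ?T p = a_kernel R S h"
    unfolding a_kernel_def' using p0 ker by (intro Collect_cong conj_cong refl) metis
  have surj: "p ` carrier R = carrier ?T"
    unfolding p_def carrier_quot image_image[symmetric] ..
  let ?Q = "R Quot a_kernel R S h"
  define f where "f = (\<lambda>Y. the_elem (p ` Y))"
  define g where "g = (\<lambda>Y. the_elem (h ` Y))"
  have f: "f \<in> ring_iso ?Q ?T" unfolding f_def using p.FactRing_iso_set[OF surj] K by simp
  have g: "g \<in> ring_iso ?Q (S\<lparr>carrier := h ` carrier R\<rparr>)" unfolding g_def by (rule FactRing_iso_set_aux)
  have Q: "ring ?Q" by (intro ideal.quotient_is_ring kernel_is_ideal)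
  define \<theta> where "\<theta> = g \<circ> inv_into (carrier ?Q) f"
  have "\<theta> \<in> ring_iso ?T (S\<lparr>carrier := h ` carrier R\<rparr>)"
    unfolding \<theta>_def by (rule ring_iso_set_trans[OF ring_iso_set_sym[OF Q f] g])
  moreover have "\<theta> (p r) = h r" if r: "r \<in> carrier R" for r
  proof -
    have c: "a_kernel R S h +>\<^bsub>R\<^esub> r \<in> carrier ?Q"
      using r by (auto simp: FactRing_def A_RCOSETS_def')
    have "f (a_kernel R S h +>\<^bsub>R\<^esub> r) = p r" using p.the_elem_simp[OF r] K by (simp add: f_def)
    moreover have "inj_on f (carrier ?Q)" using ring_iso_memE(5)[OF f] by (simp add: bij_betw_def)
    ultimately have "inv_into (carrier ?Q) f (p r) = a_kernel R S h +>\<^bsub>R\<^esub> r"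
      using c inv_into_f_f by metis
    then show ?thesis using the_elem_simp[OF r] by (simp add: \<theta>_def g_def)
  qed
  ultimately show ?thesis unfolding p_def by blast
qed

text \<open>This matches \<open>C_alg\<close>, which is defined by generators, with the image of a
  homomorphism.\<close>

lemma generate_ring_eq_hom_image:
  assumes "ring_hom_ring R S h" "A \<subseteq> carrier R" "generate_ring R A = carrier R"
  shows "generate_ring S (h ` A) = h ` carrier R"
proof -
  interpret ring_hom_ring R S h by fact
  have "h r \<in> generate_ring S (h ` A)" if "r \<in> generate_ring R A" for r
    using that
  proof induction
    case (incl r) then show ?case by (auto intro: generate_ring.incl)
  qed (use assms(3) in \<open>auto intro: generate_ring.intros\<close>)
  moreover have "generate_ring S (h ` A) \<subseteq> h ` carrier R"
    using assms(2) by (intro S.generate_ring_min_subring1 img_is_subring R.carrier_is_subring) auto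
  ultimately show ?thesis using assms(3) by blast
qed

lemma generate_cpoly_ring:
  "generate_ring (cpoly_ring W) (range cpoly_const \<union> cpoly_var ` W) = carrier (cpoly_ring W)"
proof
  interpret cring "cpoly_ring W" by (rule cring_cpoly)
  show "generate_ring (cpoly_ring W) (range cpoly_const \<union> cpoly_var ` W) \<subseteq> carrier (cpoly_ring W)"
    by (rule generate_ring_incl) (auto intro: cpoly_in)
  have "q \<in> generate_ring (cpoly_ring W) (range cpoly_const \<union> cpoly_var ` W)"
    if "q \<in> carrier (cpoly_ring W)" for q
    using that
  proof (induction q rule: cpoly_induct)
    case (add p r) then show ?case using generate_ring.eng_add cpoly_ops(2) by metis
  next
    case (mult p r) then show ?case using generate_ring.eng_mult cpoly_ops(1) by metis
  qed (auto intro: generate_ring.incl)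
  then show "carrier (cpoly_ring W) \<subseteq> generate_ring (cpoly_ring W) (range cpoly_const \<union> cpoly_var ` W)"
    by blast
qed

section \<open>Nilpotency of linear forms in \<open>\<Phi>\<^sub>N\<close>\<close>

text \<open>The binomial expansion modulo \<open>y ^ 2\<close>, with \<open>a ^ k\<close> factored
  out of the two surviving terms so that nilpotency of \<open>a\<close> can be used.\<close>

lemma power_binomial_mod_square:
  assumes "a \<in> carrier (cpoly_ring W)" "y \<in> carrier (cpoly_ring W)"
  shows "\<exists>w\<in>carrier (cpoly_ring W).
    (a + y) ^ Suc k = a ^ k * (a + cpoly_const (of_nat (Suc k)) * y) + w * y ^ 2"
proof (induction k)
  case 0
  show ?case by (rule bexI[of _ 0]) (auto intro: cpoly_in)
next
  case (Suc k)
  then obtain w where w: "w \<in> carrier (cpoly_ring W)"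
    "(a + y) ^ Suc k = a ^ k * (a + cpoly_const (of_nat (Suc k)) * y) + w * y ^ 2" by blast
  have c: "cpoly_const (of_nat (Suc (Suc k))) = cpoly_const (of_nat (Suc k)) + (1 :: 'a cpoly)"
    using cpoly_const_add[of "of_nat (Suc k)" 1] by (simp add: add_ac)
  have "(a + y) ^ Suc (Suc k) = (a + y) * (a ^ k * (a + cpoly_const (of_nat (Suc k)) * y) + w * y ^ 2)"
    using w(2) by simp
  also have "\<dots> = a ^ Suc k * (a + cpoly_const (of_nat (Suc (Suc k))) * y) +
      (a ^ k * cpoly_const (of_nat (Suc k)) + w * (a + y)) * y ^ 2"
    unfolding c by (simp add: algebra_simps power2_eq_square)
  finally show ?case
    using w(1) assms
    by (intro bexI[of _ "a ^ k * cpoly_const (of_nat (Suc k)) + w * (a + y)"]) (auto intro!: cpoly_in)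
qed

text \<open>Each further summand with square in \<open>I\<close> costs one more power: modulo its
  square, the expansion still contains the previous sum to the power known to lie in
  \<open>I\<close>.\<close>

lemma nilpotent_sum:
  assumes I: "ideal I (cpoly_ring W)" and "finite A"
    and y: "\<And>i. i \<in> A \<Longrightarrow> y i \<in> carrier (cpoly_ring W)" "\<And>i. i \<in> A \<Longrightarrow> y i ^ 2 \<in> I"
  shows "(\<Sum>i\<in>A. y i) ^ Suc (card A) \<in> I"
  using assms(2,3,4)
proof (induction A rule: finite_induct)
  case empty
  then show ?case by (simp add: ideal_cpoly[OF I])
next
  case (insert i A)
  let ?a = "\<Sum>i\<in>A. y i"
  have a: "?a \<in> carrier (cpoly_ring W)" "y i \<in> carrier (cpoly_ring W)"
    using insert.prems by (auto intro: cpoly_in)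
  obtain w where w: "w \<in> carrier (cpoly_ring W)" "(?a + y i) ^ Suc (Suc (card A)) =
      ?a ^ Suc (card A) * (?a + cpoly_const (of_nat (Suc (Suc (card A)))) * y i) + w * y i ^ 2"
    using power_binomial_mod_square[OF a, of "Suc (card A)"] by blast
  have "(?a + cpoly_const (of_nat (Suc (Suc (card A)))) * y i) * ?a ^ Suc (card A) \<in> I"
    using insert a by (intro ideal_cpoly(4)[OF I]) (auto intro!: cpoly_in)
  moreover have "w * y i ^ 2 \<in> I" using insert w by (intro ideal_cpoly(4)[OF I]) auto
  ultimately have "(?a + y i) ^ Suc (Suc (card A)) \<in> I"
    unfolding w(2) by (subst mult.commute) (rule ideal_cpoly(3)[OF I])
  then show ?case using insert.hyps by (simp add: add.commute)
qed

lemma ideal_power_congr: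
  assumes I: "ideal I (cpoly_ring W)" and "p - q \<in> I"
    "p \<in> carrier (cpoly_ring W)" "q \<in> carrier (cpoly_ring W)"
  shows "p ^ k - q ^ k \<in> I"
  using assms by (induction k) (auto intro!: ideal_cpoly_mult[OF I] cpoly_in simp: ideal_cpoly[OF I])

lemma var_sum_congr:
  assumes "finite A" "\<And>i. i \<in> A \<Longrightarrow> f i \<in> dual_space s W"
  shows "cpoly_var (\<Sum>i\<in>A. fun_scale (c i) (f i)) - (\<Sum>i\<in>A. cpoly_const (c i) * cpoly_var (f i))
    \<in> sym_ideal fun_scale (dual_space s W) \<and> (\<Sum>i\<in>A. fun_scale (c i) (f i)) \<in> dual_space s W"
  using assms
proof (induction A rule: finite_induct)
  case empty
  have "0 \<in> dual_space s W" by (simp add: dual_space_def)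
  then show ?case using var_zero_congr[of s W] by (simp add: zero_fun_def)
next
  case (insert i A)
  let ?g = "\<Sum>i\<in>A. fun_scale (c i) (f i)"
  have g: "?g \<in> dual_space s W"
    "cpoly_var ?g - (\<Sum>i\<in>A. cpoly_const (c i) * cpoly_var (f i)) \<in> sym_ideal fun_scale (dual_space s W)"
    using insert by auto
  have fi: "f i \<in> dual_space s W" using insert by auto
  define g' where "g' = fun_scale (c i) (f i) + ?g"
  have g'_in: "g' \<in> dual_space s W"
    unfolding g'_def by (rule dual_space_add[OF dual_space_scale[OF fi] g(1)])
  have "cpoly_var g' - (cpoly_var (fun_scale (c i) (f i)) + cpoly_var ?g)
      \<in> sym_ideal fun_scale (dual_space s W)"
    unfolding g'_def by (rule var_add_congr[OF dual_space_scale[OF fi] g(1)])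
  from sym_ideal_simps(3)[OF sym_ideal_simps(3)[OF this g(2)] var_scale_congr[OF fi, of "c i"]]
  have "cpoly_var g' - (\<Sum>i\<in>insert i A. cpoly_const (c i) * cpoly_var (f i))
      \<in> sym_ideal fun_scale (dual_space s W)"
    using insert.hyps by (simp add: algebra_simps)
  then show ?case
    unfolding sum.insert[OF insert.hyps, of "\<lambda>i. fun_scale (c i) (f i)"] g'_def[symmetric]
    using g'_in by blast
qed

section \<open>The substitution induced by \<open>p\<^sup>*\<close>\<close>

lemma cpoly_ring_power: "q [^]\<^bsub>cpoly_ring W\<^esub> (k::nat) = q ^ k"
  by (induction k) (simp_all add: nat_pow_def cpoly_ops mult.commute)

lemma sym_incl_power:
  assumes "f \<in> dual_space s W"
  shows "sym_incl fun_scale (dual_space s W) f [^]\<^bsub>Sym fun_scale (dual_space s W)\<^esub> (k::nat) =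
    sym_ideal fun_scale (dual_space s W) +>\<^bsub>cpoly_ring (dual_space s W)\<^esub> (cpoly_var f ^ k)"
  using ring_hom_ring.hom_nat_pow[OF ideal.rcos_ring_hom_ring[OF ideal_sym_dual] cpoly_var_in[OF assms]]
  by (simp add: sym_incl_def Sym_def cpoly_ring_power)

text \<open>The algebra map induced by the dual of \<open>p\<close>, at the level of polynomials,
  before any relations are imposed.\<close>

definition p_subst ::
    "(complex \<Rightarrow> 'e::ab_group_add \<Rightarrow> 'e) \<Rightarrow> nat \<Rightarrow> (nat \<Rightarrow> 'e) \<Rightarrow> ('e \<Rightarrow> complex) cpoly
      \<Rightarrow> ((nat \<Rightarrow> complex) \<Rightarrow> complex) cpoly" where
  "p_subst s N v = cpoly_eval cpoly_const (\<lambda>l. cpoly_var (p_dual s N v l))"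

lemmas p_subst_simps = cpoly_subst.eval_simps[where a = "\<lambda>l. cpoly_var (p_dual s N v l)" for s N v,
    folded p_subst_def]

lemma p_dual_linear:
  "p_dual s N v (f + g) = p_dual s N v f + p_dual s N v g"
  "p_dual s N v (fun_scale c f) = fun_scale c (p_dual s N v f)"
  by (auto simp: p_dual_def fun_scale_def)

text \<open>Elements of \<open>F_dual N\<close> are extended by zero and are therefore not linear on
  all sequences. Composed with this projection onto the coordinate space they are, and the calculus
  on a whole type applies.\<close>

definition coord_truncate :: "nat \<Rightarrow> (nat \<Rightarrow> complex) \<Rightarrow> nat \<Rightarrow> complex" where
  "coord_truncate N x = (\<lambda>i. if i \<in> {1..N} then x i else 0)"

lemma coord_truncate_in: "coord_truncate N x \<in> coord_space N"
  by (simp add: coord_truncate_def coord_space_def)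

lemma p_map_truncate: "p_map s N v (coord_truncate N x) = p_map s N v x"
  by (simp add: p_map_def coord_truncate_def)

abbreviation ev_F :: "nat \<Rightarrow> ((nat \<Rightarrow> complex) \<Rightarrow> complex) cpoly \<Rightarrow> (nat \<Rightarrow> complex) \<Rightarrow> complex" where
  "ev_F N q x \<equiv> poly_fun q (\<lambda>f. f (coord_truncate N x))"

lemma ev_F_p_subst: "ev_F N (p_subst s N v q) x = poly_fun q (\<lambda>l. l (p_map s N v x))"
  by (induction q rule: cpoly_induct_UNIV)
     (auto simp: p_subst_simps complex_eval.eval_simps p_dual_def coord_truncate_in p_map_truncate)

definition unit_vectors :: "nat \<Rightarrow> (nat \<Rightarrow> complex) list" where
  "unit_vectors N = map (\<lambda>i j. if j = i then 1 else 0) [1..<Suc N]"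

interpretation coord: complex_space "fun_scale :: complex \<Rightarrow> (nat \<Rightarrow> complex) \<Rightarrow> (nat \<Rightarrow> complex)"
  by unfold_locales (auto simp: fun_scale_def algebra_simps)

lemma coordinate_functional: "(\<lambda>x. x i) \<in> E_dual (fun_scale :: complex \<Rightarrow> (nat \<Rightarrow> complex) \<Rightarrow> _)"
  by (auto simp: dual_space_def fun_scale_def)

lemma truncated_functional:
  assumes "f \<in> F_dual N"
  shows "(\<lambda>x. f (coord_truncate N x)) \<in> E_dual fun_scale"
proof -
  have "coord_truncate N (x + y) = coord_truncate N x + coord_truncate N y"
    "coord_truncate N (fun_scale c x) = fun_scale c (coord_truncate N x)" for x y c
    by (auto simp: coord_truncate_def fun_scale_def)
  then show ?thesis using assms coord_truncate_in[of N] by (auto simp: dual_space_def)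
qed

lemma ev_F_polyfun: "q \<in> carrier (cpoly_ring (F_dual N)) \<Longrightarrow> ev_F N q \<in> polyfun fun_scale"
  by (induction q rule: cpoly_induct)
     (auto simp: complex_eval.eval_simps intro: polyfun.intros truncated_functional)

text \<open>At most one unit vector has a nonzero \<open>i\<close>-th coordinate, so a second power
  of that coordinate suffices.\<close>

lemma vanishing_square:
  "squarefree_vanishing fun_scale (unit_vectors N) (\<lambda>x. x i ^ 2)"
proof -
  have "length (filter (\<lambda>u. u i \<noteq> 0) (unit_vectors N)) = length (filter (\<lambda>j. j = i) [1..<Suc N])"
    unfolding unit_vectors_def filter_map length_map
    by (intro arg_cong[of _ _ length] filter_cong refl) auto
  also have "\<dots> = card {j \<in> {1..<Suc N}. j = i}"
    using distinct_length_filter[of "[1..<Suc N]" "\<lambda>j. j = i"] by (simp add: Int_def conj_commute del: upt_Suc)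
  also have "\<dots> \<le> 1" by (rule order_trans[OF card_mono[of "{i}"]]) auto
  finally have "length (filter (\<lambda>u. u i \<noteq> 0) (unit_vectors N)) \<le> 1" .
  from coord.vanishing_functional_power[OF coordinate_functional this] show ?thesis
    by (simp add: numeral_2_eq_2)
qed

context complex_space begin

lemma p_map_linear:
  "p_map s N v (x + fun_scale c y) = p_map s N v x + s c (p_map s N v y)"
  by (simp add: p_map_def fun_scale_def scale_left_distrib sum.distrib scale_sum_right)

text \<open>Chain rule for the linear map \<open>p\<close>: differentiating the composite along
  \<open>u\<close> is differentiating \<open>f\<close> along the image of \<open>u\<close>. Since
  unit vectors map to the \<open>v i\<close>, conditions on the coordinate space become conditions
  on \<open>V\<close>.\<close>

lemma vanishing_p_map:
  "squarefree_vanishing fun_scale us (\<lambda>x. f (p_map s N v x)) \<longleftrightarrow>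
    squarefree_vanishing s (map (p_map s N v) us) f"
proof (induction us arbitrary: f)
  case Nil
  show ?case by (simp add: p_map_def)
next
  case (Cons u us)
  have "dirderiv fun_scale u (\<lambda>x. f (p_map s N v x)) = (\<lambda>x. dirderiv s (p_map s N v u) f (p_map s N v x))"
    by (rule ext) (simp add: dirderiv_def p_map_linear)
  then show ?case by (simp add: Cons.IH)
qed

lemma p_map_unit_vectors: "map (p_map s N v) (unit_vectors N) = map v [1..<Suc N]"
proof -
  have "p_map s N v (\<lambda>j. if j = i then 1 else 0) = v i" if "i \<in> {1..N}" for i
  proof -
    have "p_map s N v (\<lambda>j. if j = i then 1 else 0) = (\<Sum>j\<in>{1..N}. if j = i then v j else 0)"
      unfolding p_map_def by (intro sum.cong) auto
    then show ?thesis using that by simp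
  qed
  then show ?thesis by (auto simp: unit_vectors_def)
qed

lemma p_subst_in:
  "q \<in> carrier (cpoly_ring (E_dual s)) \<Longrightarrow> p_subst s N v q \<in> carrier (cpoly_ring (F_dual N))"
  by (induction q rule: cpoly_induct)
     (auto simp: p_subst_simps intro!: cpoly_in p_dual_in vector_space_axioms)

lemma p_subst_hom: "p_subst s N v \<in> ring_hom (cpoly_ring (E_dual s)) (cpoly_ring (F_dual N))"
  by (rule ring_hom_memI) (simp_all add: p_subst_in cpoly_ops p_subst_simps)

end

section \<open>Comparison of the two ideals inside polynomial rings\<close>

definition coord_squares :: "nat \<Rightarrow> ((nat \<Rightarrow> complex) \<Rightarrow> complex) cpoly set" where
  "coord_squares N = {cpoly_var (coord_functional N i) ^ 2 | i. i \<in> {1..N}}"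

definition essential_powers ::
    "(complex \<Rightarrow> 'e::ab_group_add \<Rightarrow> 'e) \<Rightarrow> nat \<Rightarrow> (nat \<Rightarrow> 'e) \<Rightarrow> ('e \<Rightarrow> complex) cpoly set" where
  "essential_powers s N v = {cpoly_var l ^ (hyperplane_degree N v H + 1) | H l. essential_vector s N v H l}"

abbreviation squares_preimage :: "nat \<Rightarrow> ((nat \<Rightarrow> complex) \<Rightarrow> complex) cpoly set" where
  "squares_preimage N \<equiv>
    quot_genideal (cpoly_ring (F_dual N)) (sym_ideal fun_scale (F_dual N)) (coord_squares N)"

abbreviation I_preimage ::
    "(complex \<Rightarrow> 'e::ab_group_add \<Rightarrow> 'e) \<Rightarrow> nat \<Rightarrow> (nat \<Rightarrow> 'e) \<Rightarrow> ('e \<Rightarrow> complex) cpoly set" where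
  "I_preimage s N v \<equiv>
    quot_genideal (cpoly_ring (E_dual s)) (sym_ideal fun_scale (E_dual s)) (essential_powers s N v)"

lemma coord_squares_in: "coord_squares N \<subseteq> carrier (cpoly_ring (F_dual N))"
  by (auto simp: coord_squares_def intro!: cpoly_in coord_functional_in)

lemma essential_powers_in: "essential_powers s N v \<subseteq> carrier (cpoly_ring (E_dual s))"
  unfolding essential_powers_def essential_vector_def by (auto intro!: cpoly_in simp del: power_Suc)

lemma squares_preimage_iff:
  "q \<in> squares_preimage N \<longleftrightarrow> q \<in> carrier (cpoly_ring (F_dual N)) \<and>
    sym_ideal fun_scale (F_dual N) +>\<^bsub>cpoly_ring (F_dual N)\<^esub> q \<in> squares_ideal N"
proof -
  have "{sym_incl fun_scale (F_dual N) (coord_functional N i) [^]\<^bsub>Sym_F_dual N\<^esub> (2::nat) | i. i \<in> {1..N}} =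
      (+>\<^bsub>cpoly_ring (F_dual N)\<^esub>) (sym_ideal fun_scale (F_dual N)) ` coord_squares N"
    by (force simp: coord_squares_def sym_incl_power coord_functional_in)
  then show ?thesis by (simp add: quot_genideal_def squares_ideal_def Sym_def)
qed

lemma I_preimage_iff:
  "q \<in> I_preimage s N v \<longleftrightarrow> q \<in> carrier (cpoly_ring (E_dual s)) \<and>
    sym_ideal fun_scale (E_dual s) +>\<^bsub>cpoly_ring (E_dual s)\<^esub> q \<in> I_ideal s N v"
proof -
  let ?c = "(+>\<^bsub>cpoly_ring (E_dual s)\<^esub>) (sym_ideal fun_scale (E_dual s))"
  have pow: "sym_incl fun_scale (E_dual s) l [^]\<^bsub>Sym_E_dual s\<^esub> k = ?c (cpoly_var l ^ k)"
    if "essential_vector s N v H l" for H l and k :: nat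
    using that by (intro sym_incl_power) (simp add: essential_vector_def)
  have "{sym_incl fun_scale (E_dual s) l [^]\<^bsub>Sym_E_dual s\<^esub> (hyperplane_degree N v H + 1) | H l.
        essential_vector s N v H l} =
      {?c (cpoly_var l ^ (hyperplane_degree N v H + 1)) | H l. essential_vector s N v H l}"
    by (rule Collect_cong) (metis pow)
  also have "\<dots> = ?c ` essential_powers s N v"
    unfolding essential_powers_def by blast
  finally have "{sym_incl fun_scale (E_dual s) l [^]\<^bsub>Sym_E_dual s\<^esub> (hyperplane_degree N v H + 1) | H l.
        essential_vector s N v H l} = ?c ` essential_powers s N v" .
  then show ?thesis by (simp add: quot_genideal_def I_ideal_def Sym_def)
qed

lemma ideal_squares_preimage: "ideal (squares_preimage N) (cpoly_ring (F_dual N))"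
  by (rule ideal.quot_genideal_ideal[OF ideal_sym_dual coord_squares_in])

lemma ideal_I_preimage: "ideal (I_preimage s N v) (cpoly_ring (E_dual s))"
  by (rule ideal.quot_genideal_ideal[OF ideal_sym_dual essential_powers_in])

text \<open>The polynomials with this property form an ideal that contains the linear relations,
  which evaluate to zero, and the squares of the coordinates; minimality gives the
  inclusion.\<close>

lemma squares_preimage_vanishing:
  assumes "q \<in> squares_preimage N"
  shows "squarefree_vanishing fun_scale (unit_vectors N) (ev_F N q)"
proof -
  let ?J = "{q \<in> carrier (cpoly_ring (F_dual N)). squarefree_vanishing fun_scale (unit_vectors N) (ev_F N q)}"
  have "ideal ?J (cpoly_ring (F_dual N))"
  proof (rule idealI_cpoly)
    show "0 \<in> ?J" by (simp add: cpoly_in complex_eval.eval_simps coord.vanishing_zero)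
    show "p + q \<in> ?J" if "p \<in> ?J" "q \<in> ?J" for p q
      using that coord.vanishing_add[of "ev_F N p" "ev_F N q" "unit_vectors N"]
      by (simp add: cpoly_in complex_eval.eval_simps ev_F_polyfun)
    show "q * p \<in> ?J" if "q \<in> carrier (cpoly_ring (F_dual N))" "p \<in> ?J" for p q
      using that coord.vanishing_mult[of "ev_F N p" "ev_F N q" "unit_vectors N"]
      by (simp add: cpoly_in complex_eval.eval_simps ev_F_polyfun mult.commute)
  qed auto
  moreover have "sym_ideal fun_scale (F_dual N) \<subseteq> ?J"
  proof
    fix q assume q: "q \<in> sym_ideal fun_scale (F_dual N)"
    have "ev_F N q x = 0" for x
      by (rule ideal_poly_fun_zero[OF _ q, of "{\<lambda>f. f (coord_truncate N x)}"]) (auto simp: fun_scale_def)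
    then show "q \<in> ?J"
      using subsetD[OF sym_ideal_simps(1) q] by (simp add: coord.vanishing_zero)
  qed
  moreover have "coord_squares N \<subseteq> ?J"
  proof
    fix q assume "q \<in> coord_squares N"
    then obtain i where i: "i \<in> {1..N}" "q = cpoly_var (coord_functional N i) ^ 2"
      by (auto simp: coord_squares_def)
    then have "ev_F N q x = x i ^ 2" for x
      using coord_truncate_in[of N x]
      by (simp add: complex_eval.eval_simps coord_functional_def) (simp add: coord_truncate_def)
    then show "q \<in> ?J" using vanishing_square i by (auto intro!: cpoly_in coord_functional_in)
  qed
  ultimately have "squares_preimage N \<subseteq> ?J" by (rule ideal.quot_genideal_minimal[OF ideal_sym_dual])
  with assms show ?thesis by blast
qed

text \<open>The image of \<open>l\<close> is the combination of coordinate functionals with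
  coefficients \<open>l (v i)\<close>. Only the indices in \<open>?A\<close> contribute, each with a
  term of square zero modulo the ideal, so \<open>nilpotent_sum\<close> applies.\<close>

lemma p_dual_power_mem:
  assumes s: "vector_space s" and l: "l \<in> E_dual s"
  shows "cpoly_var (p_dual s N v l) ^ Suc (card {i \<in> {1..N}. l (v i) \<noteq> 0}) \<in> squares_preimage N"
proof -
  interpret complex_space s by (rule complex_space.intro[OF s])
  let ?A = "{i \<in> {1..N}. l (v i) \<noteq> 0}"
  let ?y = "\<lambda>i. cpoly_const (l (v i)) * cpoly_var (coord_functional N i)"
  note I = ideal_squares_preimage[of N]
  have coord: "coord_functional N i \<in> F_dual N" if "i \<in> ?A" for i
    using that by (intro coord_functional_in) auto
  have "l (p_map s N v x) = (\<Sum>i\<in>{1..N}. x i * l (v i))" for x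
  proof -
    have "l (\<Sum>i\<in>B. s (x i) (v i)) = (\<Sum>i\<in>B. x i * l (v i))" for B
      by (induction B rule: infinite_finite_induct) (auto simp: functional_simps[OF l])
    then show ?thesis by (simp add: p_map_def)
  qed
  moreover have "(\<Sum>i\<in>{1..N}. x i * l (v i)) = (\<Sum>i\<in>?A. l (v i) * x i)" for x
    by (rule sum.mono_neutral_cong_right) auto
  moreover have "(\<Sum>i\<in>B. fun_scale (l (v i)) (coord_functional N i)) x =
      (if x \<in> coord_space N then \<Sum>i\<in>B. l (v i) * x i else 0)" for B x
    by (induction B rule: infinite_finite_induct) (auto simp: fun_scale_def coord_functional_def)
  ultimately have p: "p_dual s N v l = (\<Sum>i\<in>?A. fun_scale (l (v i)) (coord_functional N i))"
    by (auto simp: p_dual_def)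
  have "cpoly_var (\<Sum>i\<in>?A. fun_scale (l (v i)) (coord_functional N i)) - (\<Sum>i\<in>?A. ?y i)
      \<in> sym_ideal fun_scale (F_dual N)"
    by (rule conjunct1[OF var_sum_congr]) (use coord in auto)
  then have "cpoly_var (p_dual s N v l) - (\<Sum>i\<in>?A. ?y i) \<in> squares_preimage N"
    unfolding p using ideal.quot_genideal_base[OF ideal_sym_dual coord_squares_in, of N] by blast
  moreover have y: "?y i \<in> carrier (cpoly_ring (F_dual N))" if "i \<in> ?A" for i
    using coord[OF that] by (auto intro: cpoly_in)
  ultimately have "cpoly_var (p_dual s N v l) ^ Suc (card ?A) - (\<Sum>i\<in>?A. ?y i) ^ Suc (card ?A) \<in> squares_preimage N"
    using p_dual_in[OF s l] by (intro ideal_power_congr[OF I]) (auto intro: cpoly_in)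
  moreover have "?y i ^ 2 \<in> squares_preimage N" if "i \<in> ?A" for i
  proof -
    have "cpoly_var (coord_functional N i) ^ 2 \<in> squares_preimage N"
      using ideal.quot_genideal_generators[OF ideal_sym_dual coord_squares_in, of N] that
      by (auto simp: coord_squares_def)
    then show ?thesis
      unfolding power_mult_distrib by (intro ideal_cpoly(4)[OF I]) (auto intro: cpoly_in)
  qed
  then have "(\<Sum>i\<in>?A. ?y i) ^ Suc (card ?A) \<in> squares_preimage N"
    by (intro nilpotent_sum[OF I] y) auto
  ultimately show ?thesis using ideal_cpoly(3)[OF I] by fastforce
qed

text \<open>The preimage of \<open>squares_preimage N\<close> under the substitution is an ideal, so
  it is enough to check the linear relations and the powers of essential vectors.\<close>

lemma I_preimage_subset:
  assumes s: "vector_space s" and q: "q \<in> I_preimage s N v"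
  shows "p_subst s N v q \<in> squares_preimage N"
proof -
  interpret complex_space s by (rule complex_space.intro[OF s])
  let ?J = "{q \<in> carrier (cpoly_ring (E_dual s)). p_subst s N v q \<in> squares_preimage N}"
  note base = ideal.quot_genideal_base[OF ideal_sym_dual coord_squares_in, of N]
  have J: "ideal ?J (cpoly_ring (E_dual s))"
    by (rule ring_hom_ring.ideal_vimage[OF ring_hom_ringI2[OF cring.axioms(1)[OF cring_cpoly]
        cring.axioms(1)[OF cring_cpoly] p_subst_hom] ideal_squares_preimage])
  moreover have "sym_ideal fun_scale (E_dual s) \<subseteq> ?J"
    using base var_add_congr[of _ fun_scale "coord_space N"] var_scale_congr[of _ fun_scale "coord_space N"]
    by (intro sym_ideal_minimal J)
       (auto simp: p_subst_simps p_dual_linear p_dual_in[OF s] dual_space_add dual_space_scale intro!: cpoly_in)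
  moreover have "essential_powers s N v \<subseteq> ?J"
  proof
    fix q assume "q \<in> essential_powers s N v"
    then obtain H l where l: "essential_vector s N v H l" "q = cpoly_var l ^ Suc (hyperplane_degree N v H)"
      by (auto simp: essential_powers_def)
    then have "l \<in> E_dual s" "hyperplane_degree N v H = card {i \<in> {1..N}. l (v i) \<noteq> 0}"
      by (auto simp: essential_vector_def hyperplane_degree_def)
    then show "q \<in> ?J"
      using p_dual_power_mem[OF s, of l N v] unfolding l(2)
      by (auto simp: p_subst_simps(5)[symmetric] p_subst_simps(3)[symmetric] intro!: cpoly_in simp del: power_Suc)
  qed
  ultimately have "I_preimage s N v \<subseteq> ?J" by (rule ideal.quot_genideal_minimal[OF ideal_sym_dual])
  with q show ?thesis by blast
qed

context complex_space begin

text \<open>A basis of the kernel chosen inside \<open>S\<close>, together with one vector off the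
  kernel, is a basis of the space. Finiteness of \<open>S\<close> makes the two cardinalities differ
  by exactly one.\<close>

lemma linear_hyperplane_kernel:
  assumes l: "l \<in> E_dual s" "l \<noteq> 0" and ker: "span S = {x. l x = 0}" and "finite S"
  shows "linear_hyperplane s {x. l x = 0}"
proof -
  obtain B where B: "B \<subseteq> S" "independent B" "S \<subseteq> span B"
    using maximal_independent_subset by blast
  have span_B: "span B = {x. l x = 0}"
    using B ker span_mono[of B S] span_minimal[OF B(3) subspace_span] by auto
  have "finite B" using B(1) \<open>finite S\<close> by (rule finite_subset)
  obtain w where w: "l w \<noteq> 0" using l(2) by (auto simp: fun_eq_iff)
  then have w_B: "w \<notin> span B" by (simp add: span_B)
  have "x \<in> span (insert w B)" for x
  proof -
    have "l x = l (x - s (l x / l w) w) + l x"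
      using functional_simps(1)[OF l(1), of "x - s (l x / l w) w" "s (l x / l w) w"] w
      by (simp add: functional_simps(2)[OF l(1)])
    then have "x - s (l x / l w) w \<in> span B" by (simp add: span_B)
    then show ?thesis by (auto simp: span_breakdown_eq)
  qed
  then have "span (insert w B) = span (UNIV :: 'e set)" by auto
  then have "dim (UNIV :: 'e set) = card (insert w B)"
    by (rule dim_eq_card[OF _ independent_insertI[OF w_B B(2)]])
  moreover have "dim {x. l x = 0} = card B"
    by (rule dim_eq_card[OF _ B(2)]) (simp only: span_B[symmetric] span_span)
  moreover have "w \<notin> B" using w_B span_base by blast
  ultimately show ?thesis
    using \<open>finite B\<close> by (simp add: linear_hyperplane_def span_B[symmetric])
qed

lemma essential_ideal_subset_I_preimage:
  assumes "G \<in> essential_ideal s (map v [1..<Suc N]) {}"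
  shows "G \<in> I_preimage s N v"
  using assms
proof (induction rule: essential_ideal.induct)
  case zero
  show ?case by (rule ideal_cpoly(2)[OF ideal_I_preimage])
next
  case (step G q l)
  let ?vs = "map v [1..<Suc N]"
  have l: "l \<in> E_dual s" using step by (simp add: annihilator_def)
  have S: "span {u \<in> set ?vs. l u = 0} = {x. l x = 0}" using step.hyps(5) by simp
  have "{v i | i. i \<in> {1..N} \<and> l (v i) = 0} = {u \<in> set ?vs. l u = 0}" by auto
  then have "essential_vector s N v {x. l x = 0} l"
    using S l step(4) linear_hyperplane_kernel[OF l step(4) S]
    by (simp add: essential_vector_def essential_hyperplane_def)
  \<comment> \<open>Positions in the list correspond to indices, so repeated vectors are counted
    with multiplicity on both sides.\<close>
  moreover have "length (filter (\<lambda>u. l u \<noteq> 0) ?vs) = hyperplane_degree N v {x. l x = 0}"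
  proof -
    have "length (filter (\<lambda>u. l u \<noteq> 0) ?vs) = length (filter (\<lambda>i. l (v i) \<noteq> 0) [1..<Suc N])"
      by (simp add: filter_map comp_def del: upt_Suc)
    also have "\<dots> = card {i \<in> {1..N}. l (v i) \<noteq> 0}"
      by (subst distinct_length_filter) (auto intro!: arg_cong[of _ _ card])
    finally show ?thesis by (simp add: hyperplane_degree_def)
  qed
  ultimately have "cpoly_var l ^ Suc (length (filter (\<lambda>u. l u \<noteq> 0) ?vs)) \<in> essential_powers s N v"
    unfolding essential_powers_def by (auto simp del: power_Suc)
  then have "cpoly_var l ^ Suc (length (filter (\<lambda>u. l u \<noteq> 0) ?vs)) \<in> I_preimage s N v"
    using ideal.quot_genideal_generators[OF ideal_sym_dual essential_powers_in, of s N v] by blast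
  then show ?case
    using step.IH C_subset[OF step(2)]
    by (intro ideal_cpoly(3)[OF ideal_I_preimage] ideal_cpoly(4)[OF ideal_I_preimage])
qed

text \<open>Membership of the image in the ideal of squares forces the mixed derivatives along
  \<open>V\<close> to vanish, and \<open>essential_ideal_complete\<close> then puts \<open>q\<close>
  into the ideal of essential powers. The other direction is the nilpotency estimate.\<close>

lemma I_preimage_eq:
  assumes "span (v ` {1..N}) = UNIV" and q: "q \<in> carrier (cpoly_ring (E_dual s))"
  shows "q \<in> I_preimage s N v \<longleftrightarrow> p_subst s N v q \<in> squares_preimage N"
proof
  assume "p_subst s N v q \<in> squares_preimage N"
  from squares_preimage_vanishing[OF this]
  have "squarefree_vanishing fun_scale (unit_vectors N) (\<lambda>x. ev q (p_map s N v x))"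
    by (simp add: ev_F_p_subst)
  then have K: "squarefree_vanishing s (map v [1..<Suc N]) (ev q)"
    using vanishing_p_map[of "unit_vectors N" "ev q"] by (simp add: p_map_unit_vectors del: upt_Suc)
  have "span ({} \<union> set (map v [1..<Suc N])) = UNIV"
    using assms(1) by (simp add: atLeastLessThanSuc_atLeastAtMost del: upt_Suc)
  moreover have "q \<in> C {}" using q by (simp add: annihilator_def)
  ultimately obtain G where G: "G \<in> essential_ideal s (map v [1..<Suc N]) {}" "q - G \<in> Z"
    using essential_ideal_complete K by blast
  have "q - G \<in> I_preimage s N v"
    using ideal.quot_genideal_base[OF ideal_sym_dual essential_powers_in, of s N v] G(2) by blast
  from ideal_cpoly(3)[OF ideal_I_preimage this essential_ideal_subset_I_preimage[OF G(1)]]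
  show "q \<in> I_preimage s N v" by simp
qed (rule I_preimage_subset[OF vector_space_axioms])

end

section \<open>Descent of the substitution to the quotient\<close>

theorem theorem4:
  fixes s :: "complex \<Rightarrow> 'e::ab_group_add \<Rightarrow> 'e"
    and v :: "nat \<Rightarrow> 'e"
    and N n :: nat
  assumes "vector_space s"
    and "vector_space.dim s (UNIV :: 'e set) = n"
    and "module.span s (v ` {1..N}) = UNIV"
  shows "\<exists>\<theta>. \<theta> \<in> ring_iso (Sym_E_dual s Quot I_ideal s N v) (C_alg s N v) \<and>
      (\<forall>c. \<theta> (I_ideal s N v +>\<^bsub>Sym_E_dual s\<^esub> sym_const fun_scale (E_dual s) c) = phi_const N c) \<and>
      (\<forall>l\<in>E_dual s. \<theta> (I_ideal s N v +>\<^bsub>Sym_E_dual s\<^esub> sym_incl fun_scale (E_dual s) l)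
                    = phi_incl N (p_dual s N v l))"
proof -
  interpret complex_space s by (rule complex_space.intro[OF assms(1)])
  let ?R = "cpoly_ring (E_dual s)"
  \<comment> \<open>The map starts from the free polynomial ring, so well-definedness on the
    quotients reduces to the computation of its kernel.\<close>
  define h where "h = (\<lambda>q. squares_ideal N +>\<^bsub>Sym_F_dual N\<^esub>
    (sym_ideal fun_scale (F_dual N) +>\<^bsub>cpoly_ring (F_dual N)\<^esub> p_subst s N v q))"
  have h_const: "h (cpoly_const c) = phi_const N c" for c
    by (simp add: h_def phi_const_def sym_const_def p_subst_simps)
  have h_var: "h (cpoly_var l) = phi_incl N (p_dual s N v l)" for l
    by (simp add: h_def phi_incl_def sym_incl_def p_subst_simps)
  have "h \<in> ring_hom ?R (Phi N)"
    using ring_hom_trans[OF ring_hom_trans[OF p_subst_hom ideal.rcos_ring_hom[OF ideal_sym_dual], folded Sym_def]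
        ideal.rcos_ring_hom[OF ideal_squares]]
    by (simp add: h_def Phi_def comp_def)
  then have h: "ring_hom_ring ?R (Phi N) h"
    by (intro ring_hom_ringI2 cring.axioms(1) cring_cpoly cring_Phi)
  \<comment> \<open>Both conditions become ideal membership of polynomials, where
    \<open>I_preimage_eq\<close> compares them.\<close>
  have zero: "sym_ideal fun_scale (E_dual s) +>\<^bsub>?R\<^esub> q \<in> I_ideal s N v \<longleftrightarrow> h q = \<zero>\<^bsub>Phi N\<^esub>"
    if q: "q \<in> carrier ?R" for q
  proof -
    let ?x = "sym_ideal fun_scale (F_dual N) +>\<^bsub>cpoly_ring (F_dual N)\<^esub> p_subst s N v q"
    interpret J: ideal "squares_ideal N" "Sym_F_dual N" by (rule ideal_squares)
    have x: "?x \<in> carrier (Sym_F_dual N)"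
      using p_subst_in[OF q] by (auto simp: Sym_def carrier_quot)
    have "sym_ideal fun_scale (E_dual s) +>\<^bsub>?R\<^esub> q \<in> I_ideal s N v \<longleftrightarrow> ?x \<in> squares_ideal N"
      using I_preimage_eq[OF assms(3) q] q p_subst_in[OF q]
      by (simp add: I_preimage_iff squares_preimage_iff)
    also have "\<dots> \<longleftrightarrow> squares_ideal N +>\<^bsub>Sym_F_dual N\<^esub> ?x = squares_ideal N"
      using J.a_rcos_const[of ?x] J.a_rcos_self[OF x] by auto
    finally show ?thesis by (simp add: h_def Phi_def FactRing_def)
  qed
  \<comment> \<open>Constants and variables generate the polynomial ring, and their images are the
    generators in the definition of \<open>C_alg\<close>.\<close>
  have "h ` carrier ?R = generate_ring (Phi N) (h ` (range cpoly_const \<union> cpoly_var ` E_dual s))"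
    by (rule generate_ring_eq_hom_image[OF h _ generate_cpoly_ring, symmetric]) (auto intro: cpoly_in)
  also have "h ` (range cpoly_const \<union> cpoly_var ` E_dual s) =
      range (phi_const N) \<union> phi_incl N ` (p_dual s N v ` E_dual s)"
    by (simp add: image_Un image_image h_const h_var)
  finally have img: "(Phi N)\<lparr>carrier := h ` carrier ?R\<rparr> = C_alg s N v" by (simp add: C_alg_def)
  from ring_hom_ring.iterated_quotient_iso[OF h ideal_sym_dual ideal_I[unfolded Sym_def] zero,
      folded Sym_def, unfolded img]
  obtain \<theta> where \<theta>: "\<theta> \<in> ring_iso (Sym_E_dual s Quot I_ideal s N v) (C_alg s N v)"
    "\<And>q. q \<in> carrier ?R \<Longrightarrow> \<theta> (I_ideal s N v +>\<^bsub>Sym_E_dual s\<^esub>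
      (sym_ideal fun_scale (E_dual s) +>\<^bsub>?R\<^esub> q)) = h q"
    by blast
  show ?thesis
    by (rule exI[of _ \<theta>])
       (use \<theta> in \<open>auto simp: sym_const_def sym_incl_def h_const h_var cpoly_in\<close>)
qed

end
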